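(* Let $n\ge 3$. The Schur multiplier $H_2(\mathrm{UT}_n(\mathbb Z),\mathbb Z)$ of the group of upper unitriangular $n\times n$ integer matrices is isomorphic to $$(\mathbb Z/2\mathbb Z)^{n-3}\oplus\mathbb Z^{\frac{(n+1)(n-2)}{2}}.$$ *)

theory Defs
  imports "HOL-Algebra.Algebra" "HOL-Library.Poly_Mapping"
begin

definition UT_carrier :: "nat \<Rightarrow> (nat \<Rightarrow> nat \<Rightarrow> int) set" where
  "UT_carrier n = {A. \<forall>i j. (n \<le> i \<or> n \<le> j \<longrightarrow> A i j = 0)
                       \<and> (i < n \<and> j < n \<and> i = j \<longrightarrow> A i j = 1)
                       \<and> (i < n \<and> j < n \<and> j < i \<longrightarrow> A i j = 0)}"

definition UT :: "nat \<Rightarrow> (nat \<Rightarrow> nat \<Rightarrow> int) monoid" where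
  "UT n = \<lparr> carrier = UT_carrier n,
            monoid.mult = (\<lambda>A B i j. if i < n \<and> j < n then (\<Sum>k<n. A i k * B k j) else 0),
            one = (\<lambda>i j. if i = j \<and> i < n then 1 else 0) \<rparr>"

definition chains :: "('a, 'b) monoid_scheme \<Rightarrow> nat \<Rightarrow> ('a list \<Rightarrow>\<^sub>0 int) monoid" where
  "chains G k = free_Abelian_group {xs. length xs = k \<and> set xs \<subseteq> carrier G}"

definition bd2 :: "('a, 'b) monoid_scheme \<Rightarrow> ('a list \<Rightarrow>\<^sub>0 int) \<Rightarrow> ('a list \<Rightarrow>\<^sub>0 int)" where
  "bd2 G = frag_extend (\<lambda>xs. frag_of [xs!1] - frag_of [xs!0 \<otimes>\<^bsub>G\<^esub> xs!1] + frag_of [xs!0])"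

definition bd3 :: "('a, 'b) monoid_scheme \<Rightarrow> ('a list \<Rightarrow>\<^sub>0 int) \<Rightarrow> ('a list \<Rightarrow>\<^sub>0 int)" where
  "bd3 G = frag_extend (\<lambda>xs. frag_of [xs!1, xs!2] - frag_of [xs!0 \<otimes>\<^bsub>G\<^esub> xs!1, xs!2]
                           + frag_of [xs!0, xs!1 \<otimes>\<^bsub>G\<^esub> xs!2] - frag_of [xs!0, xs!1])"

definition cycles2 :: "('a, 'b) monoid_scheme \<Rightarrow> ('a list \<Rightarrow>\<^sub>0 int) set" where
  "cycles2 G = {c \<in> carrier (chains G 2). bd2 G c = 0}"

definition boundaries2 :: "('a, 'b) monoid_scheme \<Rightarrow> ('a list \<Rightarrow>\<^sub>0 int) set" where
  "boundaries2 G = bd3 G ` carrier (chains G 3)"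

definition H2 :: "('a, 'b) monoid_scheme \<Rightarrow> ('a list \<Rightarrow>\<^sub>0 int) set monoid" where
  "H2 G = ((chains G 2)\<lparr>carrier := cycles2 G\<rparr>) Mod (boundaries2 G)"

definition Z2_plus_Z :: "nat \<Rightarrow> nat \<Rightarrow> (nat \<Rightarrow> int) monoid" where
  "Z2_plus_Z a b = product_group {..<a + b}
      (\<lambda>i. if i < a then integer_mod_group 2 else integer_group)"

end

theory Submission
  imports Defs
begin

text \<open>For commuting \<open>g\<close>, \<open>h\<close> the cycle \<open>[g|h] - [h|g]\<close> is, modulo boundaries, bimultiplicative and invariant
  under conjugation; in a central extension it is the commutator of lifts. Hence the classes of all
  commuting pairs of elementary matrices are combinations of those belonging to the standard
  relators of \<open>UT n\<close>, and conjugating twice shows that the relator \<open>[e\<^sub>1\<^sub>3, e\<^sub>2\<^sub>4]\<close> has order at most 2.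
  If a subgroup \<open>S\<close> of the 2-chains contains the boundaries and all these classes, then the central
  extension by chains modulo \<open>S\<close> with cocycle \<open>[g|h]\<close> splits: a section is built one elementary matrix
  at a time along a polycyclic series. A splitting forces every 2-cycle into \<open>S\<close>.
  Explicit cocycles (cup products, Massey products on Heisenberg blocks, and a cocycle modulo 2 on
  4 by 4 blocks) are dual to the relators. Applying the above to the subgroup of chains that
  agree modulo boundaries with the combination of relators prescribed by these cocycles identifies
  the homology.\<close>

section \<open>Unitriangular matrices and elementary matrices\<close>

text \<open>The cocycles bound \<open>H_2\<close> from below; the difficulty is the upper bound. A
  splitting supplies it because it makes \<open>[g|h]\<close> a coboundary modulo \<open>S\<close>.
  The lifts of elementary matrices must satisfy all relations at once, so off the first
  superdiagonal they are defined as commutators; what then remains to be assumed is that lifts of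
  commuting pairs commute. The 2-torsion comes from \<open>a < b < c < d\<close>: one conjugation
  identifies the class of \<open>(e b c, e a d)\<close> with that of \<open>(e a c, e b d)\<close>,
  another with its negative. If the four indices are not consecutive, the class of
  \<open>(e a c, e b d)\<close> vanishes, since one of the two matrices is a commutator of matrices
  commuting with the other. Consecutive indices leave \<open>n - 3\<close> classes, which the
  cocycle modulo 2 shows to be nonzero. The free rank counts pairs among the \<open>n - 1\<close>
  superdiagonal generators, an adjacent pair standing for one Heisenberg relator, plus a second
  Heisenberg relator for each of the \<open>n - 2\<close> adjacent pairs:
  \<open>(n-1)(n-2)/2 + (n-2) = (n+1)(n-2)/2\<close>.\<close>

definition elm :: "nat \<Rightarrow> nat \<Rightarrow> nat \<Rightarrow> int \<Rightarrow> nat \<Rightarrow> nat \<Rightarrow> int" where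
  "elm n i j z = (\<lambda>a b. if a < n \<and> b < n then (if a = b then 1 else if a = i \<and> b = j then z else 0) else 0)"

lemma UT_carrier_iff:
  "A \<in> UT_carrier n \<longleftrightarrow>
     (\<forall>i j. (n \<le> i \<or> n \<le> j \<longrightarrow> A i j = 0) \<and> (i < n \<longrightarrow> A i i = 1) \<and> (j < i \<longrightarrow> A i j = 0))"
  (is "?L \<longleftrightarrow> ?R")
proof
  assume *: ?R
  then have "A i j = 0" if "j < i" for i j using that by blast
  with * show ?L unfolding UT_carrier_def by blast
next
  assume *: ?L
  then have "A i j = 0" if "j < i" for i j
    using that unfolding UT_carrier_def by (cases "i < n") (auto simp: not_less)
  with * show ?R unfolding UT_carrier_def by blast
qed

lemma carrier_UT [simp]: "carrier (UT n) = UT_carrier n"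
  by (simp add: UT_def)

lemma UT_one: "\<one>\<^bsub>UT n\<^esub> = (\<lambda>i j. if i = j \<and> i < n then 1 else 0)"
  by (simp add: UT_def)

lemma UT_mult: "A \<otimes>\<^bsub>UT n\<^esub> B = (\<lambda>i j. if i < n \<and> j < n then (\<Sum>k<n. A i k * B k j) else 0)"
  by (simp add: UT_def)

lemma UT_mult_entry:
  assumes "A \<in> UT_carrier n" "B \<in> UT_carrier n" "j < n"
  shows "(A \<otimes>\<^bsub>UT n\<^esub> B) i j = (\<Sum>k=i..j. A i k * B k j)"
proof (cases "i < n")
  case True
  have "(\<Sum>k<n. A i k * B k j) = (\<Sum>k=i..j. A i k * B k j)"
    using assms by (intro sum.mono_neutral_right) (auto simp: UT_carrier_iff)
  then show ?thesis using True assms by (simp add: UT_mult)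
next
  case False
  then show ?thesis using assms by (simp add: UT_mult)
qed

lemma UT_mult_closed:
  assumes "A \<in> UT_carrier n" "B \<in> UT_carrier n"
  shows "A \<otimes>\<^bsub>UT n\<^esub> B \<in> UT_carrier n"
  unfolding UT_carrier_iff
proof (intro allI conjI impI)
  fix i j
  show "n \<le> i \<or> n \<le> j \<Longrightarrow> (A \<otimes>\<^bsub>UT n\<^esub> B) i j = 0" by (auto simp: UT_mult)
  show "i < n \<Longrightarrow> (A \<otimes>\<^bsub>UT n\<^esub> B) i i = 1"
    using assms by (simp add: UT_mult_entry) (simp add: UT_carrier_iff)
  show "j < i \<Longrightarrow> (A \<otimes>\<^bsub>UT n\<^esub> B) i j = 0"
  proof (cases "j < n")
    case True
    then show "j < i \<Longrightarrow> ?thesis" using assms by (simp add: UT_mult_entry)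
  qed (simp add: UT_mult)
qed

lemma UT_monoid: "monoid (UT n)"
proof (rule monoidI)
  fix A B C assume "A \<in> carrier (UT n)" "B \<in> carrier (UT n)" "C \<in> carrier (UT n)"
  show "A \<otimes>\<^bsub>UT n\<^esub> B \<otimes>\<^bsub>UT n\<^esub> C = A \<otimes>\<^bsub>UT n\<^esub> (B \<otimes>\<^bsub>UT n\<^esub> C)"
  proof (intro ext)
    fix i j
    show "(A \<otimes>\<^bsub>UT n\<^esub> B \<otimes>\<^bsub>UT n\<^esub> C) i j = (A \<otimes>\<^bsub>UT n\<^esub> (B \<otimes>\<^bsub>UT n\<^esub> C)) i j"
      by (auto simp: UT_mult sum_distrib_left sum_distrib_right mult.assoc intro!: sum.swap)
  qed
next
  fix A assume "A \<in> carrier (UT n)"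
  then have A: "A \<in> UT_carrier n" by simp
  have 1: "(\<Sum>k<n. (if i = k then 1 else 0) * A k j) = A i j" if "i < n" for i j
  proof -
    have "(\<Sum>k<n. (if i = k then 1 else 0) * A k j) = (\<Sum>k<n. if i = k then A i j else 0)"
      by (intro sum.cong) auto
    then show ?thesis using that by simp
  qed
  have 2: "(\<Sum>k<n. A i k * (if k = j then 1 else 0)) = A i j" if "j < n" for i j
  proof -
    have "(\<Sum>k<n. A i k * (if k = j then 1 else 0)) = (\<Sum>k<n. if k = j then A i j else 0)"
      by (intro sum.cong) auto
    then show ?thesis using that by simp
  qed
  show "\<one>\<^bsub>UT n\<^esub> \<otimes>\<^bsub>UT n\<^esub> A = A" using A by (auto simp: UT_one UT_mult 1 UT_carrier_iff intro!: ext)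
  show "A \<otimes>\<^bsub>UT n\<^esub> \<one>\<^bsub>UT n\<^esub> = A" using A by (auto simp: UT_one UT_mult 2 UT_carrier_iff intro!: ext)
qed (auto simp: UT_mult_closed, auto simp: UT_one UT_carrier_iff)

lemma elm_closed [simp]: "i < j \<Longrightarrow> elm n i j z \<in> UT_carrier n"
  by (auto simp: elm_def UT_carrier_iff)

lemma elm_0 [simp]: "elm n i j 0 = \<one>\<^bsub>UT n\<^esub>"
  by (auto simp: UT_one elm_def fun_eq_iff)

lemma UT_mult_elm:
  assumes "A \<in> UT_carrier n" "i < j" "j < n"
  shows "A \<otimes>\<^bsub>UT n\<^esub> elm n i j z = (\<lambda>a b. A a b + (if b = j then z * A a i else 0))"
proof (intro ext)
  fix a b
  show "(A \<otimes>\<^bsub>UT n\<^esub> elm n i j z) a b = A a b + (if b = j then z * A a i else 0)"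
  proof (cases "a < n \<and> b < n")
    case True
    have "(\<Sum>k<n. A a k * elm n i j z k b) =
      (\<Sum>k<n. (if k = b then A a b else 0) + (if k = i then if b = j then z * A a i else 0 else 0))"
      using True assms by (intro sum.cong) (auto simp: elm_def)
    also have "\<dots> = A a b + (if b = j then z * A a i else 0)"
      using True assms by (simp add: sum.distrib)
    finally show ?thesis using True by (simp add: UT_mult)
  next
    case False
    then show ?thesis using assms by (auto simp: UT_mult UT_carrier_iff)
  qed
qed

lemma elm_add:
  "i < j \<Longrightarrow> j < n \<Longrightarrow> elm n i j y \<otimes>\<^bsub>UT n\<^esub> elm n i j z = elm n i j (y + z)"
  by (simp add: UT_mult_elm) (auto simp: elm_def fun_eq_iff)

text \<open>Columns are filled from left to right and each column from the top down;
  \<open>(i, k)\<close> is the next free position. In this order the newest entry is additive under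
  multiplication, so each stage is the kernel of a homomorphism from the next one to the
  integers.\<close>

definition UT_stage :: "nat \<Rightarrow> nat \<Rightarrow> nat \<Rightarrow> (nat \<Rightarrow> nat \<Rightarrow> int) set" where
  "UT_stage n k i = {A \<in> UT_carrier n. \<forall>l m. l < m \<and> (k < m \<or> k = m \<and> i \<le> l) \<longrightarrow> A l m = 0}"

lemma UT_stage_0 [simp]: "UT_stage n 0 0 = {\<one>\<^bsub>UT n\<^esub>}"
proof -
  have "A a b = (if a = b \<and> a < n then 1 else 0)" if "A \<in> UT_stage n 0 0" for A a b
    using that by (cases a b rule: linorder_cases) (auto simp: UT_stage_def UT_carrier_iff)
  then show ?thesis by (auto simp: UT_one UT_stage_def UT_carrier_iff fun_eq_iff)
qed

text \<open>Column \<open>k\<close> has exactly \<open>k\<close> positions above the diagonal; after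
  them the next column begins.\<close>

lemma UT_stage_diag: "UT_stage n (Suc k) 0 = UT_stage n k k"
  by (auto simp: UT_stage_def) (metis Suc_lessI not_less_eq nat_less_le)+

lemma UT_stage_full: "UT_stage n n 0 = UT_carrier n"
  by (auto simp: UT_stage_def UT_carrier_iff)

lemma UT_stage_subset: "UT_stage n k i \<subseteq> UT_carrier n"
  by (auto simp: UT_stage_def)

lemma UT_stage_step:
  assumes "A \<in> UT_stage n k (Suc i)" "i < k" "k < n"
  shows "A \<otimes>\<^bsub>UT n\<^esub> elm n i k (- A i k) \<in> UT_stage n k i"
proof -
  have A: "A \<in> UT_carrier n" using assms by (simp add: UT_stage_def)
  then have "A \<otimes>\<^bsub>UT n\<^esub> elm n i k (- A i k) \<in> UT_carrier n"
    using assms by (simp add: UT_mult_closed)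
  moreover have "A l m + (if m = k then - A i k * A l i else 0) = 0"
    if "l < m" "k < m \<or> k = m \<and> i \<le> l" for l m
    using that assms by (cases "l = i") (auto simp: UT_stage_def UT_carrier_iff)
  ultimately show ?thesis using A assms by (simp add: UT_stage_def UT_mult_elm)
qed

lemma UT_stage_induct [consumes 0, case_names base step diag]:
  assumes "Q 0 0"
    and "\<And>k i. i < k \<Longrightarrow> k < n \<Longrightarrow> Q k i \<Longrightarrow> Q k (Suc i)"
    and "\<And>k. k < n \<Longrightarrow> Q k k \<Longrightarrow> Q (Suc k) 0"
  shows "Q n 0"
proof -
  have "k \<le> n \<Longrightarrow> Q k 0" for k
  proof (induction k)
    case (Suc k)
    have "i \<le> k \<Longrightarrow> Q k i" for i
      using Suc assms by (induction i) auto
    then show ?case using Suc assms(3) by auto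
  qed (use assms in auto)
  then show ?thesis by simp
qed

lemma UT_mult_elm_cancel:
  assumes "A \<in> UT_carrier n" "i < j" "j < n"
  shows "A = (A \<otimes>\<^bsub>UT n\<^esub> elm n i j (- z)) \<otimes>\<^bsub>UT n\<^esub> elm n i j z"
proof -
  interpret monoid "UT n" by (rule UT_monoid)
  have "(A \<otimes>\<^bsub>UT n\<^esub> elm n i j (- z)) \<otimes>\<^bsub>UT n\<^esub> elm n i j z = A \<otimes>\<^bsub>UT n\<^esub> \<one>\<^bsub>UT n\<^esub>"
    using assms by (subst m_assoc) (simp_all add: elm_add)
  then show ?thesis using assms r_one[of A] by simp
qed

text \<open>The newest entry is peeled off by an elementary factor on the right and then restored.
  \<open>H\<close> is any set stable under such factors rather than a subgroup, because the lemma
  serves to produce inverses in the first place: \<open>UT_group\<close> applies it to the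
  units.\<close>

lemma UT_stage_generated:
  assumes "\<one>\<^bsub>UT n\<^esub> \<in> H"
    and "\<And>A l m z. A \<in> UT_carrier n \<Longrightarrow> A \<in> H \<Longrightarrow> l < m \<Longrightarrow> m < k \<or> m = k \<and> l < i \<Longrightarrow> m < n
           \<Longrightarrow> A \<otimes>\<^bsub>UT n\<^esub> elm n l m z \<in> H"
    and "i \<le> k" "k \<le> n"
  shows "UT_stage n k i \<subseteq> H"
proof -
  have step: "UT_stage n k' (Suc i') \<subseteq> H"
    if "UT_stage n k' i' \<subseteq> H" "i' < k'" "k' < n" "k' < k \<or> k' = k \<and> i' < i" for k' i'
  proof
    fix A assume A: "A \<in> UT_stage n k' (Suc i')"
    let ?B = "A \<otimes>\<^bsub>UT n\<^esub> elm n i' k' (- A i' k')"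
    have "?B \<in> UT_stage n k' i'" using A that by (intro UT_stage_step) auto
    then have "?B \<in> H" "?B \<in> UT_carrier n" using that UT_stage_subset by blast+
    then have "?B \<otimes>\<^bsub>UT n\<^esub> elm n i' k' (A i' k') \<in> H"
      using that by - (rule assms(2), auto)
    moreover have "A \<in> UT_carrier n" using A by (simp add: UT_stage_def)
    ultimately show "A \<in> H" using UT_mult_elm_cancel[of A n i' k' "A i' k'"] that by simp
  qed
  have cols: "k' \<le> k \<Longrightarrow> UT_stage n k' 0 \<subseteq> H" for k'
  proof (induction k')
    case 0 then show ?case using assms(1) by simp
  next
    case (Suc k')
    have "i' \<le> k' \<Longrightarrow> UT_stage n k' i' \<subseteq> H" for i'
    proof (induction i')
      case (Suc i') then show ?case using step[of k' i'] \<open>Suc k' \<le> k\<close> assms(4) by auto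
    qed (use Suc in auto)
    then show ?case by (simp add: UT_stage_diag)
  qed
  show ?thesis
  proof (cases "k = n \<or> i = 0")
    case True
    then show ?thesis using cols[of k] assms(3) UT_stage_full UT_stage_subset[of n k i] by auto
  next
    case False
    have "i' \<le> i \<Longrightarrow> UT_stage n k i' \<subseteq> H" for i'
    proof (induction i')
      case (Suc i') then show ?case using step[of k i'] assms False by auto
    qed (use cols in auto)
    then show ?thesis by simp
  qed
qed

lemma UT_group: "group (UT n)"
proof -
  interpret monoid "UT n" by (rule UT_monoid)
  have "UT_stage n n 0 \<subseteq> Units (UT n)"
  proof (rule UT_stage_generated)
    fix A l m z assume *: "A \<in> Units (UT n)" "l < m" "m < n"
    then have "elm n l m z \<in> Units (UT n)"
      unfolding Units_def by (auto intro!: bexI[of _ "elm n l m (- z)"] simp: elm_add)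
    then show "A \<otimes>\<^bsub>UT n\<^esub> elm n l m z \<in> Units (UT n)" using * by blast
  qed auto
  then have "A \<in> UT_carrier n \<Longrightarrow> A \<in> Units (UT n)" for A
    by (auto simp: UT_stage_full)
  then show ?thesis
    by (intro group.intro UT_monoid group_axioms.intro) (auto simp: Units_def)
qed

section \<open>Central extensions from chains modulo boundaries\<close>

definition add_subgroup :: "'a::ab_group_add set \<Rightarrow> bool" where
  "add_subgroup S \<longleftrightarrow> 0 \<in> S \<and> (\<forall>x\<in>S. \<forall>y\<in>S. x - y \<in> S)"

lemma add_subgroup_0: "add_subgroup S \<Longrightarrow> 0 \<in> S"
  and add_subgroup_diff: "add_subgroup S \<Longrightarrow> x \<in> S \<Longrightarrow> y \<in> S \<Longrightarrow> x - y \<in> S"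
  by (auto simp: add_subgroup_def)

lemma add_subgroup_uminus: "add_subgroup S \<Longrightarrow> x \<in> S \<Longrightarrow> - x \<in> S"
  using add_subgroup_diff[of S 0 x] by (simp add: add_subgroup_0)

lemma add_subgroup_add: "add_subgroup S \<Longrightarrow> x \<in> S \<Longrightarrow> y \<in> S \<Longrightarrow> x + y \<in> S"
  using add_subgroup_diff[of S x "- y"] by (simp add: add_subgroup_uminus)

section \<open>Bar chains and boundaries in low degrees\<close>

lemma carrier_chains [simp]:
  "carrier (chains G k) = {c. Poly_Mapping.keys c \<subseteq> {xs. length xs = k \<and> set xs \<subseteq> carrier G}}"
  by (simp add: chains_def free_Abelian_group_def)

lemma chains_induct [consumes 1, case_names zero of diff]:
  assumes "c \<in> carrier (chains G k)" "P 0"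
    "\<And>xs. length xs = k \<Longrightarrow> set xs \<subseteq> carrier G \<Longrightarrow> P (frag_of xs)"
    "\<And>a b. P a \<Longrightarrow> P b \<Longrightarrow> P (a - b)"
  shows "P c"
  by (rule frag_induction[where S="{xs. length xs = k \<and> set xs \<subseteq> carrier G}"])
    (use assms in auto)

lemma bd2_frag [simp]: "bd2 G (frag_of [x, y]) = frag_of [y] - frag_of [x \<otimes>\<^bsub>G\<^esub> y] + frag_of [x]"
  by (simp add: bd2_def)

lemma bd3_frag [simp]: "bd3 G (frag_of [x, y, z]) =
    frag_of [y, z] - frag_of [x \<otimes>\<^bsub>G\<^esub> y, z] + frag_of [x, y \<otimes>\<^bsub>G\<^esub> z] - frag_of [x, y]"
  by (simp add: bd3_def numeral_2_eq_2)

lemma bd2_diff: "bd2 G (a - b) = bd2 G a - bd2 G b"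
  and bd3_diff: "bd3 G (a - b) = bd3 G a - bd3 G b"
  by (simp_all add: bd2_def bd3_def frag_extend_diff)

lemma bd2_0 [simp]: "bd2 G 0 = 0" and bd3_0 [simp]: "bd3 G 0 = 0"
  by (simp_all add: bd2_def bd3_def)

lemma boundaries2_add_subgroup: "add_subgroup (boundaries2 G)"
  unfolding add_subgroup_def boundaries2_def
proof (intro conjI ballI)
  show "0 \<in> bd3 G ` carrier (chains G 3)"
    by (rule image_eqI[of _ _ 0]) auto
next
  fix x y assume "x \<in> bd3 G ` carrier (chains G 3)" "y \<in> bd3 G ` carrier (chains G 3)"
  then obtain c d where *: "c \<in> carrier (chains G 3)" "x = bd3 G c" "d \<in> carrier (chains G 3)" "y = bd3 G d"
    by blast
  show "x - y \<in> bd3 G ` carrier (chains G 3)"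
    using * keys_diff[of c d] by (intro image_eqI[of _ _ "c - d"]) (auto simp: bd3_diff)
qed

lemma boundaries2I:
  assumes "x \<in> carrier G" "y \<in> carrier G" "z \<in> carrier G"
  shows "frag_of [y, z] - frag_of [x \<otimes>\<^bsub>G\<^esub> y, z] + frag_of [x, y \<otimes>\<^bsub>G\<^esub> z] - frag_of [x, y] \<in> boundaries2 G"
  unfolding boundaries2_def using assms
  by (intro image_eqI[of _ _ "frag_of [x, y, z]"]) auto

lemma boundaries2_subset:
  assumes "add_subgroup S"
    and "\<And>x y z. x \<in> carrier G \<Longrightarrow> y \<in> carrier G \<Longrightarrow> z \<in> carrier G \<Longrightarrow>
      frag_of [y, z] - frag_of [x \<otimes>\<^bsub>G\<^esub> y, z] + frag_of [x, y \<otimes>\<^bsub>G\<^esub> z] - frag_of [x, y] \<in> S"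
  shows "boundaries2 G \<subseteq> S"
proof -
  have "bd3 G c \<in> S" if "c \<in> carrier (chains G 3)" for c
    using that
  proof (induction rule: chains_induct)
    case (of xs)
    then obtain x y z where "xs = [x, y, z]"
      by (auto simp: numeral_3_eq_3 length_Suc_conv)
    then show ?case using of assms(2) by simp
  qed (simp_all add: bd3_diff assms(1) add_subgroup_0 add_subgroup_diff)
  then show ?thesis by (auto simp: boundaries2_def)
qed

text \<open>For commuting \<open>g\<close> and \<open>h\<close> this represents, up to sign, the
  image of a generator of \<open>H_2\<close> of the free abelian group of rank two under the
  homomorphism sending its basis to \<open>g\<close>, \<open>h\<close>.\<close>

definition swap2 :: "'a \<Rightarrow> 'a \<Rightarrow> 'a list \<Rightarrow>\<^sub>0 int" where
  "swap2 g h = frag_of [g, h] - frag_of [h, g]"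

lemma swap2_commute: "swap2 h g = - swap2 g h"
  by (simp add: swap2_def)

lemma swap2_self [simp]: "swap2 g g = 0"
  by (simp add: swap2_def)

text \<open>The difference is the boundary of the shuffle product of \<open>[g]\<close> with
  \<open>[h|k]\<close>, namely \<open>[g|h|k] - [h|g|k] + [h|k|g]\<close>.\<close>

lemma (in group) swap2_mult:
  assumes "g \<in> carrier G" "h \<in> carrier G" "k \<in> carrier G" "g \<otimes> h = h \<otimes> g" "g \<otimes> k = k \<otimes> g"
  shows "swap2 g (h \<otimes> k) - (swap2 g h + swap2 g k) \<in> boundaries2 G"
proof -
  have "swap2 g (h \<otimes> k) - (swap2 g h + swap2 g k) =
     (frag_of [h, k] - frag_of [g \<otimes> h, k] + frag_of [g, h \<otimes> k] - frag_of [g, h])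
   - (frag_of [g, k] - frag_of [h \<otimes> g, k] + frag_of [h, g \<otimes> k] - frag_of [h, g])
   + (frag_of [k, g] - frag_of [h \<otimes> k, g] + frag_of [h, k \<otimes> g] - frag_of [h, k])"
    using assms(4,5) by (simp add: swap2_def)
  also have "\<dots> \<in> boundaries2 G"
    using assms by (intro add_subgroup_add add_subgroup_diff boundaries2_add_subgroup boundaries2I)
  finally show ?thesis .
qed

text \<open>The prism \<open>[k|g|h] - [g'|k|h] + [g'|h'|k]\<close> is the usual homotopy between
  conjugation and the identity; it is taken here on \<open>[g|h]\<close> minus \<open>[h|g]\<close>.
  Writing conjugation as \<open>k \<otimes> g = g' \<otimes> k\<close> keeps inverses out of the
  chains.\<close>

lemma (in group) swap2_conj:
  assumes "g \<in> carrier G" "h \<in> carrier G" "g' \<in> carrier G" "h' \<in> carrier G" "k \<in> carrier G"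
    and "k \<otimes> g = g' \<otimes> k" "k \<otimes> h = h' \<otimes> k" "g \<otimes> h = h \<otimes> g" "g' \<otimes> h' = h' \<otimes> g'"
  shows "swap2 g h - swap2 g' h' \<in> boundaries2 G"
proof -
  let ?b = "\<lambda>x y z. frag_of [y, z] - frag_of [x \<otimes> y, z] + frag_of [x, y \<otimes> z] - frag_of [x, y]"
  have "swap2 g h - swap2 g' h' =
     (?b k g h - ?b g' k h + ?b g' h' k) - (?b k h g - ?b h' k g + ?b h' g' k)"
    using assms(6-9) by (simp add: swap2_def)
  also have "\<dots> \<in> boundaries2 G"
    using assms by (intro add_subgroup_add add_subgroup_diff boundaries2_add_subgroup boundaries2I)
  finally show ?thesis .
qed

definition coset_rep :: "'a::ab_group_add set \<Rightarrow> 'a \<Rightarrow> 'a" where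
  "coset_rep S x = (SOME y. y - x \<in> S)"

lemma coset_rep: "add_subgroup S \<Longrightarrow> coset_rep S x - x \<in> S"
  unfolding coset_rep_def by (rule someI[of _ x]) (simp add: add_subgroup_0)

text \<open>Elements of one coset define the same predicate under \<open>SOME\<close>, hence get the
  same representative. Equations in the quotient thus become equations between chains.\<close>

lemma coset_rep_eq_iff:
  assumes "add_subgroup S"
  shows "coset_rep S x = coset_rep S y \<longleftrightarrow> x - y \<in> S"
proof
  assume "coset_rep S x = coset_rep S y"
  then show "x - y \<in> S"
    using add_subgroup_diff[OF assms coset_rep[OF assms, of y] coset_rep[OF assms, of x]] by simp
next
  assume *: "x - y \<in> S"
  have "z - x \<in> S \<longleftrightarrow> z - y \<in> S" for z
    using add_subgroup_add[OF assms, of "z - x" "x - y"] add_subgroup_diff[OF assms, of "z - y" "x - y"] *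
    by auto
  then show "coset_rep S x = coset_rep S y" by (simp add: coset_rep_def)
qed

lemma coset_rep_simps:
  assumes "add_subgroup S"
  shows "coset_rep S (coset_rep S x) = coset_rep S x"
    "coset_rep S (coset_rep S x + y) = coset_rep S (x + y)"
    "coset_rep S (y + coset_rep S x) = coset_rep S (y + x)"
  using coset_rep[OF assms, of x] by (simp_all add: coset_rep_eq_iff[OF assms])

text \<open>Modulo a subgroup \<open>S\<close> containing the boundaries, \<open>(g, h) \<mapsto> [g|h]\<close> is the universal 2-cocycle;
  chosen coset representatives stand for the elements of the quotient.\<close>

definition cocycle_ext ::
  "('a, 'b) monoid_scheme \<Rightarrow> ('a list \<Rightarrow>\<^sub>0 int) set \<Rightarrow> (('a list \<Rightarrow>\<^sub>0 int) \<times> 'a) monoid" where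
  "cocycle_ext G S = \<lparr>carrier = {(a, g). coset_rep S a = a \<and> g \<in> carrier G},
     monoid.mult = (\<lambda>(a, g) (b, h). (coset_rep S (a + b + frag_of [g, h]), g \<otimes>\<^bsub>G\<^esub> h)),
     one = (coset_rep S (- frag_of [\<one>\<^bsub>G\<^esub>, \<one>\<^bsub>G\<^esub>]), \<one>\<^bsub>G\<^esub>)\<rparr>"

lemma cocycle_ext_simps [simp]:
  "carrier (cocycle_ext G S) = {(a, g). coset_rep S a = a \<and> g \<in> carrier G}"
  "(a, g) \<otimes>\<^bsub>cocycle_ext G S\<^esub> (b, h) = (coset_rep S (a + b + frag_of [g, h]), g \<otimes>\<^bsub>G\<^esub> h)"
  "\<one>\<^bsub>cocycle_ext G S\<^esub> = (coset_rep S (- frag_of [\<one>\<^bsub>G\<^esub>, \<one>\<^bsub>G\<^esub>]), \<one>\<^bsub>G\<^esub>)"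
  by (simp_all add: cocycle_ext_def)

text \<open>\<open>S\<close> stays general because it is used twice: as \<open>boundaries2\<close>
  itself, to bound the order of the torsion relators, and as \<open>detected\<close>, to capture all
  cycles.\<close>

locale chain_quotient = group G for G (structure) +
  fixes S
  assumes S: "add_subgroup S" and bd: "boundaries2 G \<subseteq> S"
begin

lemma cocycle:
  "x \<in> carrier G \<Longrightarrow> y \<in> carrier G \<Longrightarrow> z \<in> carrier G \<Longrightarrow>
    frag_of [y, z] - frag_of [x \<otimes> y, z] + frag_of [x, y \<otimes> z] - frag_of [x, y] \<in> S"
  using boundaries2I[of x G y z] bd by auto

text \<open>The cocycle is not normalised. Its values with one argument equal to the identity only
  agree with \<open>[\<one>|\<one>]\<close> modulo \<open>S\<close>, which explains the first
  component of the identity in \<open>cocycle_ext\<close>.\<close>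

lemma cocycle_one:
  assumes "g \<in> carrier G"
  shows "frag_of [\<one>, g] - frag_of [\<one>, \<one>] \<in> S" "frag_of [g, \<one>] - frag_of [\<one>, \<one>] \<in> S"
  using cocycle[of \<one> \<one> g] cocycle[of g \<one> \<one>] assms add_subgroup_uminus[OF S, of "frag_of [\<one>, \<one>] - frag_of [g, \<one>]"]
  by simp_all

lemma group_cocycle_ext: "group (cocycle_ext G S)"
proof (rule groupI)
  fix x y assume "x \<in> carrier (cocycle_ext G S)" "y \<in> carrier (cocycle_ext G S)"
  then show "x \<otimes>\<^bsub>cocycle_ext G S\<^esub> y \<in> carrier (cocycle_ext G S)"
    by (auto simp: coset_rep_simps[OF S])
next
  show "\<one>\<^bsub>cocycle_ext G S\<^esub> \<in> carrier (cocycle_ext G S)" by (simp add: coset_rep_simps[OF S])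
next
  fix x y z
  assume "x \<in> carrier (cocycle_ext G S)" "y \<in> carrier (cocycle_ext G S)" "z \<in> carrier (cocycle_ext G S)"
  then obtain a g b h c k where *: "x = (a, g)" "y = (b, h)" "z = (c, k)"
    "g \<in> carrier G" "h \<in> carrier G" "k \<in> carrier G" by auto
  have "a + b + frag_of [g, h] + c + frag_of [g \<otimes> h, k] - (a + (b + c + frag_of [h, k]) + frag_of [g, h \<otimes> k])
     = - (frag_of [h, k] - frag_of [g \<otimes> h, k] + frag_of [g, h \<otimes> k] - frag_of [g, h])" by simp
  also have "\<dots> \<in> S" using cocycle[of g h k] * by (intro add_subgroup_uminus[OF S])
  finally have "coset_rep S (a + b + frag_of [g, h] + c + frag_of [g \<otimes> h, k]) =
      coset_rep S (a + (b + c + frag_of [h, k]) + frag_of [g, h \<otimes> k])"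
    by (simp add: coset_rep_eq_iff[OF S])
  moreover have "coset_rep S (coset_rep S u + v + w) = coset_rep S (u + v + w)"
    "coset_rep S (v + coset_rep S u + w) = coset_rep S (v + u + w)" for u v w
    using coset_rep_simps(2)[OF S, of u "v + w"] by (simp_all add: ac_simps)
  ultimately show "x \<otimes>\<^bsub>cocycle_ext G S\<^esub> y \<otimes>\<^bsub>cocycle_ext G S\<^esub> z = x \<otimes>\<^bsub>cocycle_ext G S\<^esub> (y \<otimes>\<^bsub>cocycle_ext G S\<^esub> z)"
    using * by (simp add: m_assoc)
next
  fix x assume "x \<in> carrier (cocycle_ext G S)"
  then obtain a g where x: "x = (a, g)" "coset_rep S a = a" "g \<in> carrier G" by auto
  have "- frag_of [\<one>, \<one>] + a + frag_of [\<one>, g] - a \<in> S" using cocycle_one[OF x(3)] by simp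
  then have "coset_rep S (- frag_of [\<one>, \<one>] + a + frag_of [\<one>, g]) = a"
    using x(2) coset_rep_eq_iff[OF S] by metis
  then have "coset_rep S (coset_rep S (- frag_of [\<one>, \<one>]) + a + frag_of [\<one>, g]) = a"
    using coset_rep_simps(2)[OF S, of "- frag_of [\<one>, \<one>]" "a + frag_of [\<one>, g]"]
    by (simp only: add.assoc)
  then show "\<one>\<^bsub>cocycle_ext G S\<^esub> \<otimes>\<^bsub>cocycle_ext G S\<^esub> x = x"
    using x by simp
  \<comment> \<open>Solved from the requirement that the product have first component
    \<open>- frag_of [\<one>, \<one>]\<close>.\<close>
  let ?y = "(coset_rep S (- frag_of [\<one>, \<one>] - a - frag_of [inv g, g]), inv g)"
  have "- frag_of [\<one>, \<one>] - a - frag_of [inv g, g] + (a + frag_of [inv g, g]) = - frag_of [\<one>, \<one>]"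
    by simp
  then have "coset_rep S (fst ?y + a + frag_of [inv g, g]) = coset_rep S (- frag_of [\<one>, \<one>])"
    using coset_rep_simps(2)[OF S, of "- frag_of [\<one>, \<one>] - a - frag_of [inv g, g]" "a + frag_of [inv g, g]"]
    by (simp only: add.assoc fst_conv)
  then have "?y \<otimes>\<^bsub>cocycle_ext G S\<^esub> x = \<one>\<^bsub>cocycle_ext G S\<^esub>"
    using x by simp
  then show "\<exists>y\<in>carrier (cocycle_ext G S). y \<otimes>\<^bsub>cocycle_ext G S\<^esub> x = \<one>\<^bsub>cocycle_ext G S\<^esub>"
    using x by (intro bexI[of _ ?y]) (simp_all add: coset_rep_simps[OF S])
qed

lemma cocycle_ext_commute:
  assumes "x \<in> carrier (cocycle_ext G S)" "y \<in> carrier (cocycle_ext G S)"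
    and "snd x \<otimes> snd y = snd y \<otimes> snd x" "swap2 (snd x) (snd y) \<in> S"
  shows "x \<otimes>\<^bsub>cocycle_ext G S\<^esub> y = y \<otimes>\<^bsub>cocycle_ext G S\<^esub> x"
  using assms by (cases x; cases y) (simp add: coset_rep_eq_iff[OF S] swap2_def algebra_simps)

text \<open>The first component of a section extends linearly to a map \<open>t\<close> on 1-chains.
  That \<open>s\<close> is multiplicative says \<open>c + t (bd2 G c) \<in> S\<close> for
  \<open>c = [g|h]\<close>, hence for every 2-chain; on a cycle the second summand vanishes.\<close>

lemma cycles2_subset_if_split:
  assumes s: "s \<in> hom G (cocycle_ext G S)" and id: "\<And>g. g \<in> carrier G \<Longrightarrow> snd (s g) = g"
  shows "cycles2 G \<subseteq> S"
proof
  fix c assume c: "c \<in> cycles2 G"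
  define t where "t = frag_extend (\<lambda>xs. fst (s (hd xs)))"
  have t: "t (frag_of [g]) = fst (s g)" for g by (simp add: t_def)
  have "c + t (bd2 G c) \<in> S" if "c \<in> carrier (chains G 2)" for c
    using that
  proof (induction rule: chains_induct)
    case zero then show ?case by (simp add: t_def add_subgroup_0[OF S])
  next
    case (of xs)
    then obtain g h where xs: "xs = [g, h]" by (auto simp: numeral_2_eq_2 length_Suc_conv)
    have gh: "g \<in> carrier G" "h \<in> carrier G" using of xs by auto
    have "s (g \<otimes> h) = s g \<otimes>\<^bsub>cocycle_ext G S\<^esub> s h" using hom_mult[OF s] gh by simp
    moreover have "s g = (fst (s g), g)" "s h = (fst (s h), h)" using id gh by (metis prod.collapse)+
    ultimately have "fst (s (g \<otimes> h)) = coset_rep S (fst (s g) + fst (s h) + frag_of [g, h])"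
      by (metis cocycle_ext_simps(2) fst_conv)
    then have "- (fst (s (g \<otimes> h)) - (fst (s g) + fst (s h) + frag_of [g, h])) \<in> S"
      using coset_rep[OF S] add_subgroup_uminus[OF S] by metis
    moreover have "frag_of [g, h] + t (bd2 G (frag_of [g, h])) =
        - (fst (s (g \<otimes> h)) - (fst (s g) + fst (s h) + frag_of [g, h]))"
      unfolding bd2_frag by (simp add: t_def frag_extend_add frag_extend_diff)
    ultimately show ?case unfolding xs by argo
  next
    case (diff a b)
    then have "(a + t (bd2 G a)) - (b + t (bd2 G b)) \<in> S" by (intro add_subgroup_diff[OF S])
    moreover have "t (u - v) = t u - t v" for u v by (simp add: t_def frag_extend_diff)
    ultimately show ?case by (simp add: bd2_diff add_diff_add)
  qed
  moreover have "c \<in> carrier (chains G 2)" "bd2 G c = 0" "t 0 = 0"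
    using c by (auto simp: cycles2_def t_def)
  ultimately show "c \<in> S" by (metis add.right_neutral)
qed

end

section \<open>Splitting central extensions of the unitriangular group\<close>

text \<open>Iterates one compatible conjugation. Integer exponents follow by applying it both to
  \<open>e\<close>, \<open>y\<close> and to their inverses.\<close>

lemma (in group) conj_nat_pow:
  assumes "group E" "s \<in> K \<rightarrow> carrier E" "K \<subseteq> carrier G" "e \<in> carrier G" "y \<in> carrier E"
    and "\<And>g. g \<in> K \<Longrightarrow> e \<otimes> g \<otimes> inv e \<in> K \<and> y \<otimes>\<^bsub>E\<^esub> s g = s (e \<otimes> g \<otimes> inv e) \<otimes>\<^bsub>E\<^esub> y"
    and "g \<in> K"
  shows "e [^] (n::nat) \<otimes> g \<otimes> inv (e [^] n) \<in> K \<and>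
    y [^]\<^bsub>E\<^esub> n \<otimes>\<^bsub>E\<^esub> s g = s (e [^] n \<otimes> g \<otimes> inv (e [^] n)) \<otimes>\<^bsub>E\<^esub> y [^]\<^bsub>E\<^esub> n"
  using assms(7)
proof (induction n arbitrary: g)
  case 0
  interpret E: group E by fact
  show ?case using 0 assms(2,3) funcset_mem[OF assms(2) 0] by (auto simp: subset_iff)
next
  case (Suc n)
  interpret E: group E by fact
  let ?h = "e \<otimes> g \<otimes> inv e"
  have g: "g \<in> carrier G" "s g \<in> carrier E" and h: "?h \<in> K" "s ?h \<in> carrier E"
    using Suc.prems assms(2,3,6) by auto
  have eq: "e [^] n \<otimes> ?h \<otimes> inv (e [^] n) = e [^] Suc n \<otimes> g \<otimes> inv (e [^] Suc n)"
    using g assms(4) by (simp add: inv_mult_group m_assoc)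
  note IH = Suc.IH[OF h(1), unfolded eq]
  have "y [^]\<^bsub>E\<^esub> Suc n \<otimes>\<^bsub>E\<^esub> s g = y [^]\<^bsub>E\<^esub> n \<otimes>\<^bsub>E\<^esub> s ?h \<otimes>\<^bsub>E\<^esub> y"
    using assms(5) assms(6)[OF Suc.prems] g h by (simp add: E.m_assoc)
  also have "\<dots> = s (e [^] Suc n \<otimes> g \<otimes> inv (e [^] Suc n)) \<otimes>\<^bsub>E\<^esub> y [^]\<^bsub>E\<^esub> Suc n"
    using IH assms(2,5) by (auto simp: E.m_assoc Pi_iff)
  finally show ?case using IH by blast
qed

text \<open>A homomorphism on the kernel of \<open>\<alpha> : G \<rightarrow> \<int>\<close> extends to \<open>G = ker \<alpha> \<rtimes> \<langle>e\<rangle>\<close> by \<open>e \<mapsto> y\<close>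
  as soon as conjugation by \<open>e\<close> and by \<open>y\<close> agree.\<close>

lemma (in group) extend_hom_semidirect_int:
  assumes "group E"
    and \<alpha>: "\<And>x y. x \<in> carrier G \<Longrightarrow> y \<in> carrier G \<Longrightarrow> \<alpha> (x \<otimes> y) = \<alpha> x + (\<alpha> y :: int)"
    and K: "K = {x \<in> carrier G. \<alpha> x = 0}"
    and s: "\<And>g. g \<in> K \<Longrightarrow> s g \<in> carrier E"
      "\<And>g h. g \<in> K \<Longrightarrow> h \<in> K \<Longrightarrow> s (g \<otimes> h) = s g \<otimes>\<^bsub>E\<^esub> s h"
    and e: "e \<in> carrier G" "\<alpha> e = 1" and y: "y \<in> carrier E"
    and conj: "\<And>g. g \<in> K \<Longrightarrow> \<exists>g'\<in>K. e \<otimes> g = g' \<otimes> e \<and> y \<otimes>\<^bsub>E\<^esub> s g = s g' \<otimes>\<^bsub>E\<^esub> y"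
  shows "\<exists>s'\<in>hom G E. (\<forall>g\<in>K. s' g = s g) \<and> s' e = y"
proof -
  interpret E: group E by fact
  have K_sub: "K \<subseteq> carrier G" and s_fun: "s \<in> K \<rightarrow> carrier E" using K s by auto
  have \<alpha>1: "\<alpha> \<one> = 0" using \<alpha>[of "\<one>" "\<one>"] by simp
  have \<alpha>inv: "\<alpha> (inv x) = - \<alpha> x" if "x \<in> carrier G" for x
    using \<alpha>[of x "inv x"] that \<alpha>1 by simp
  have \<alpha>pow: "\<alpha> (e [^] (n::nat)) = int n" for n
    by (induction n) (use e \<alpha> \<alpha>1 in auto)
  have \<alpha>zpow: "\<alpha> (e [^] z) = z" for z :: int
    by (cases z rule: int_cases2) (use e \<alpha>inv \<alpha>pow in \<open>auto simp: int_pow_int int_pow_neg_int\<close>)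
  have conj1: "e \<otimes> g \<otimes> inv e \<in> K \<and> y \<otimes>\<^bsub>E\<^esub> s g = s (e \<otimes> g \<otimes> inv e) \<otimes>\<^bsub>E\<^esub> y" if g: "g \<in> K" for g
  proof -
    obtain g' where g': "g' \<in> K" "e \<otimes> g = g' \<otimes> e" "y \<otimes>\<^bsub>E\<^esub> s g = s g' \<otimes>\<^bsub>E\<^esub> y"
      using conj[OF g] by blast
    then have "e \<otimes> g \<otimes> inv e = g'"
      using e K by (simp add: m_assoc)
    then show ?thesis using g' by simp
  qed
  \<comment> \<open>The hypothesis concerns \<open>e\<close> only. For the inverse it is applied to
    the conjugate \<open>?h\<close>, which lies in \<open>K\<close> because \<alpha> takes equal
    values on conjugates.\<close>
  have conj2: "inv e \<otimes> g \<otimes> inv (inv e) \<in> K \<and>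
      inv\<^bsub>E\<^esub> y \<otimes>\<^bsub>E\<^esub> s g = s (inv e \<otimes> g \<otimes> inv (inv e)) \<otimes>\<^bsub>E\<^esub> inv\<^bsub>E\<^esub> y" if "g \<in> K" for g
  proof -
    let ?h = "inv e \<otimes> g \<otimes> e"
    have h: "?h \<in> K" using that K e by (simp add: \<alpha> \<alpha>inv)
    have "e \<otimes> ?h \<otimes> inv e = g" using that K e
      by (simp add: m_assoc[symmetric]) (simp add: m_assoc)
    then have *: "s g \<otimes>\<^bsub>E\<^esub> y = y \<otimes>\<^bsub>E\<^esub> s ?h" using conj1[OF h] by simp
    have c: "s ?h \<in> carrier E" "s g \<in> carrier E" using h that s by auto
    have "inv\<^bsub>E\<^esub> y \<otimes>\<^bsub>E\<^esub> s g = inv\<^bsub>E\<^esub> y \<otimes>\<^bsub>E\<^esub> (s g \<otimes>\<^bsub>E\<^esub> y) \<otimes>\<^bsub>E\<^esub> inv\<^bsub>E\<^esub> y"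
      using c y by (simp add: E.m_assoc)
    also have "\<dots> = s ?h \<otimes>\<^bsub>E\<^esub> inv\<^bsub>E\<^esub> y"
      using c y by (simp add: * E.m_assoc[symmetric])
    finally have "inv\<^bsub>E\<^esub> y \<otimes>\<^bsub>E\<^esub> s g = s ?h \<otimes>\<^bsub>E\<^esub> inv\<^bsub>E\<^esub> y" .
    then show ?thesis using h e by simp
  qed
  have conjz: "e [^] z \<otimes> g \<otimes> inv (e [^] z) \<in> K \<and>
      y [^]\<^bsub>E\<^esub> z \<otimes>\<^bsub>E\<^esub> s g = s (e [^] z \<otimes> g \<otimes> inv (e [^] z)) \<otimes>\<^bsub>E\<^esub> y [^]\<^bsub>E\<^esub> z"
    if "g \<in> K" for g and z :: int
  proof (cases z rule: int_cases2)
    case (nonneg n)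
    then show ?thesis
      using conj_nat_pow[OF \<open>group E\<close> s_fun K_sub e(1) y conj1 that, of n] by (simp add: int_pow_int)
  next
    case (nonpos n)
    then show ?thesis
      using conj_nat_pow[OF \<open>group E\<close> s_fun K_sub inv_closed[OF e(1)] E.inv_closed[OF y] conj2 that, of n]
      by (simp add: int_pow_neg_int E.int_pow_neg_int nat_pow_inv E.nat_pow_inv e y)
  qed
  \<comment> \<open>Normal form of the semidirect product: \<open>x\<close> is \<open>r x\<close> in
    the kernel times \<open>e\<close> to the power \<open>\<alpha> x\<close>.\<close>
  define r where "r x = x \<otimes> e [^] (- \<alpha> x)" for x
  have r: "r x \<in> K" if "x \<in> carrier G" for x
    using that e by (simp add: r_def K \<alpha> \<alpha>zpow)
  define s' where "s' x = s (r x) \<otimes>\<^bsub>E\<^esub> y [^]\<^bsub>E\<^esub> \<alpha> x" for x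
  have "s' \<in> hom G E"
  proof (rule homI)
    fix x assume "x \<in> carrier G" then show "s' x \<in> carrier E" using r s y by (simp add: s'_def)
  next
    fix x x' assume x: "x \<in> carrier G" "x' \<in> carrier G"
    let ?c = "e [^] \<alpha> x \<otimes> r x' \<otimes> inv (e [^] \<alpha> x)"
    have c: "?c \<in> K" "y [^]\<^bsub>E\<^esub> \<alpha> x \<otimes>\<^bsub>E\<^esub> s (r x') = s ?c \<otimes>\<^bsub>E\<^esub> y [^]\<^bsub>E\<^esub> \<alpha> x"
      using conjz[OF r[OF x(2)]] by auto
    have e': "e [^] (- \<alpha> x) \<otimes> (e [^] \<alpha> x \<otimes> u) = u" if "u \<in> carrier G" for u
      using that e int_pow_mult[OF e(1), of "- \<alpha> x" "\<alpha> x"] by (simp add: m_assoc[symmetric])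
    have "- (\<alpha> x + \<alpha> x') = - \<alpha> x' + - \<alpha> x" by linarith
    then have "e [^] (- (\<alpha> x + \<alpha> x')) = e [^] (- \<alpha> x') \<otimes> e [^] (- \<alpha> x)"
      by (simp only: int_pow_mult[OF e(1)])
    then have "r (x \<otimes> x') = x \<otimes> x' \<otimes> (e [^] (- \<alpha> x') \<otimes> e [^] (- \<alpha> x))"
      using x by (simp only: r_def \<alpha>)
    also have "\<dots> = r x \<otimes> ?c"
      using x e e' by (simp add: r_def m_assoc int_pow_neg)
    finally have "s (r (x \<otimes> x')) = s (r x) \<otimes>\<^bsub>E\<^esub> s ?c" using s(2) r x c(1) by simp
    moreover have "y [^]\<^bsub>E\<^esub> (\<alpha> x + \<alpha> x') = y [^]\<^bsub>E\<^esub> \<alpha> x \<otimes>\<^bsub>E\<^esub> y [^]\<^bsub>E\<^esub> \<alpha> x'"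
      using y by (simp add: E.int_pow_mult)
    moreover have "s (r x) \<in> carrier E" "s (r x') \<in> carrier E" "s ?c \<in> carrier E"
      using s(1) r x c(1) by blast+
    moreover have "s (r x) \<otimes>\<^bsub>E\<^esub> s ?c \<otimes>\<^bsub>E\<^esub> (y [^]\<^bsub>E\<^esub> \<alpha> x \<otimes>\<^bsub>E\<^esub> y [^]\<^bsub>E\<^esub> \<alpha> x') =
        s (r x) \<otimes>\<^bsub>E\<^esub> (s ?c \<otimes>\<^bsub>E\<^esub> y [^]\<^bsub>E\<^esub> \<alpha> x) \<otimes>\<^bsub>E\<^esub> y [^]\<^bsub>E\<^esub> \<alpha> x'"
      using calculation y by (simp add: E.m_assoc)
    ultimately show "s' (x \<otimes> x') = s' x \<otimes>\<^bsub>E\<^esub> s' x'"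
      using y x c(2)[symmetric] by (simp add: s'_def \<alpha> E.m_assoc)
  qed
  moreover have "s' g = s g" if "g \<in> K" for g
    using that K s by (simp add: s'_def r_def)
  moreover have "s' e = y"
  proof -
    have "\<one> \<in> K" using \<alpha>1 K by simp
    then have "s \<one> \<in> carrier E" "s \<one> \<otimes>\<^bsub>E\<^esub> s \<one> = s \<one>" using s(1) s(2)[of "\<one>" "\<one>"] by auto
    then have "s \<one> = \<one>\<^bsub>E\<^esub>" by simp
    moreover have "r e = \<one>" using e by (simp add: r_def int_pow_neg)
    ultimately show ?thesis using y e by (simp add: s'_def)
  qed
  ultimately show ?thesis by blast
qed

lemma (in group) twisted_commute_inv:
  assumes c: "a \<in> carrier G" "b \<in> carrier G" "b' \<in> carrier G" and eq: "a \<otimes> b = b' \<otimes> a"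
  shows "a \<otimes> inv b = inv b' \<otimes> a"
proof -
  have "a \<otimes> inv b = inv b' \<otimes> (b' \<otimes> a) \<otimes> inv b" using c by (simp add: m_assoc[symmetric])
  also have "\<dots> = inv b' \<otimes> a" using c unfolding eq[symmetric] by (simp add: m_assoc)
  finally show ?thesis .
qed

section \<open>Commutators of elementary matrices; the stages as subgroups\<close>

lemma UT_one_closed [simp]: "\<one>\<^bsub>UT n\<^esub> \<in> UT_carrier n"
  using monoid.one_closed[OF UT_monoid, of n] by simp

lemma UT_inv_closed [simp]: "A \<in> UT_carrier n \<Longrightarrow> inv\<^bsub>UT n\<^esub> A \<in> UT_carrier n"
  using group.inv_closed[OF UT_group, of A n] by simp

declare UT_mult_closed [simp]

lemma UT_commutator:
  assumes "i < j" "j < k" "k < n"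
  shows "elm n i j 1 \<otimes>\<^bsub>UT n\<^esub> elm n j k 1 =
    elm n i k 1 \<otimes>\<^bsub>UT n\<^esub> (elm n j k 1 \<otimes>\<^bsub>UT n\<^esub> elm n i j 1)"
proof -
  interpret G: group "UT n" by (rule UT_group)
  let ?P = "elm n i k 1 \<otimes>\<^bsub>UT n\<^esub> elm n j k 1"
  have "?P \<otimes>\<^bsub>UT n\<^esub> elm n i j 1 = (\<lambda>a b. ?P a b + (if b = j then 1 * ?P a i else 0))"
    using assms by (intro UT_mult_elm UT_mult_closed) auto
  also have "\<dots> = elm n i j 1 \<otimes>\<^bsub>UT n\<^esub> elm n j k 1"
    using assms unfolding UT_mult_elm[OF elm_closed \<open>j < k\<close> \<open>k < n\<close>, OF \<open>i < j\<close>]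
      UT_mult_elm[OF elm_closed \<open>j < k\<close> \<open>k < n\<close>, OF less_trans, OF \<open>i < j\<close> \<open>j < k\<close>]
    by (auto simp: elm_def fun_eq_iff)
  finally have "?P \<otimes>\<^bsub>UT n\<^esub> elm n i j 1 = elm n i j 1 \<otimes>\<^bsub>UT n\<^esub> elm n j k 1" .
  then show ?thesis using assms by (simp add: G.m_assoc)
qed

lemma UT_elm_commute:
  assumes "i < j" "j < n" "k < l" "l < n" "j \<noteq> k" "i \<noteq> l"
  shows "elm n i j y \<otimes>\<^bsub>UT n\<^esub> elm n k l z = elm n k l z \<otimes>\<^bsub>UT n\<^esub> elm n i j y"
  using assms by (auto simp: UT_mult_elm fun_eq_iff) (auto simp: elm_def)

lemma UT_inv_elm:
  assumes "i < j" "j < n"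
  shows "inv\<^bsub>UT n\<^esub> (elm n i j z) = elm n i j (- z)"
proof -
  interpret G: group "UT n" by (rule UT_group)
  show ?thesis using assms by (intro G.inv_equality) (simp_all add: elm_add)
qed

lemma UT_stage_elm_iff:
  assumes "l < m" "m < n" "z \<noteq> 0"
  shows "elm n l m z \<in> UT_stage n k i \<longleftrightarrow> m < k \<or> m = k \<and> l < i"
proof
  assume "elm n l m z \<in> UT_stage n k i"
  moreover have "elm n l m z l m \<noteq> 0" using assms by (simp add: elm_def)
  ultimately have "\<not> (k < m \<or> k = m \<and> i \<le> l)"
    using assms(1) unfolding UT_stage_def by blast
  then show "m < k \<or> m = k \<and> l < i" by linarith
next
  assume "m < k \<or> m = k \<and> l < i"
  then show "elm n l m z \<in> UT_stage n k i"
    using assms by (auto simp: UT_stage_def) (auto simp: elm_def)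
qed

lemma UT_stage_mult:
  assumes "A \<in> UT_stage n k i" "B \<in> UT_stage n k i"
  shows "A \<otimes>\<^bsub>UT n\<^esub> B \<in> UT_stage n k i"
proof -
  have *: "A \<in> UT_carrier n" "B \<in> UT_carrier n" using assms by (simp_all add: UT_stage_def)
  have "(A \<otimes>\<^bsub>UT n\<^esub> B) l m = 0" if "l < m" "k < m \<or> k = m \<and> i \<le> l" for l m
  proof (cases "m < n")
    case True
    have "A l p * B p m = 0" if "p \<in> {l..m}" for p
      using that \<open>l < m\<close> \<open>k < m \<or> k = m \<and> i \<le> l\<close> assms
      by (cases "p = m") (auto simp: UT_stage_def)
    then have "(\<Sum>p=l..m. A l p * B p m) = 0" by (intro sum.neutral ballI)
    then show ?thesis using * True by (simp add: UT_mult_entry)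
  qed (simp add: UT_mult)
  then show ?thesis using * by (simp add: UT_stage_def UT_mult_closed)
qed

lemma UT_stage_subset_subgroup:
  assumes H: "subgroup H (UT n)"
    and elm: "\<And>l m. l < m \<Longrightarrow> m < n \<Longrightarrow> m < k \<or> m = k \<and> l < i \<Longrightarrow> elm n l m 1 \<in> H"
    and "i \<le> k" "k \<le> n"
  shows "UT_stage n k i \<subseteq> H"
proof (rule UT_stage_generated)
  interpret H: subgroup H "UT n" by (rule H)
  interpret G: group "UT n" by (rule UT_group)
  show "\<one>\<^bsub>UT n\<^esub> \<in> H" by simp
  fix A l m z
  assume A: "A \<in> H" and lm: "l < m" "m < k \<or> m = k \<and> l < i" "m < n"
  have nat: "elm n l m (int q) \<in> H" for q
  proof (induction q)
    case (Suc q)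
    then have "elm n l m (int q) \<otimes>\<^bsub>UT n\<^esub> elm n l m 1 \<in> H" using elm[OF lm(1) lm(3) lm(2)] by blast
    then show ?case using lm by (simp add: elm_add add.commute)
  qed (use lm in simp)
  have "elm n l m z \<in> H"
  proof (cases z rule: int_cases2)
    case (nonpos q)
    then show ?thesis using H.m_inv_closed[OF nat[of q]] lm by (simp add: UT_inv_elm)
  qed (simp add: nat)
  then show "A \<otimes>\<^bsub>UT n\<^esub> elm n l m z \<in> H" using A by blast
qed (use assms in auto)

text \<open>Closure under inverses again comes from generation: the elements of the stage whose
  inverse stays in it are stable under right multiplication by the elementary matrices of the
  stage.\<close>

lemma subgroup_UT_stage:
  assumes "i \<le> k" "k \<le> n"
  shows "subgroup (UT_stage n k i) (UT n)"
proof -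
  interpret G: group "UT n" by (rule UT_group)
  let ?H = "{A \<in> UT_stage n k i. inv\<^bsub>UT n\<^esub> A \<in> UT_stage n k i}"
  have one: "\<one>\<^bsub>UT n\<^esub> \<in> UT_stage n k i"
    using G.one_closed by (simp add: UT_stage_def) (simp add: UT_one)
  have "UT_stage n k i \<subseteq> ?H"
  proof (rule UT_stage_generated)
    fix A l m z
    assume *: "A \<in> UT_carrier n" "A \<in> ?H" "l < m" "m < k \<or> m = k \<and> l < i" "m < n"
    have e: "elm n l m y \<in> UT_stage n k i" for y
      using UT_stage_elm_iff[of l m n y] * one by (cases "y = 0") auto
    have "inv\<^bsub>UT n\<^esub> (A \<otimes>\<^bsub>UT n\<^esub> elm n l m z) = elm n l m (- z) \<otimes>\<^bsub>UT n\<^esub> inv\<^bsub>UT n\<^esub> A"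
      using * by (simp add: G.inv_mult_group UT_inv_elm)
    then show "A \<otimes>\<^bsub>UT n\<^esub> elm n l m z \<in> ?H" using * e by (simp add: UT_stage_mult)
  qed (use assms one in auto)
  then show ?thesis
    using one UT_stage_subset by (intro G.subgroupI) (auto simp: UT_stage_mult)
qed

lemma UT_stage_coordinate:
  assumes "A \<in> UT_stage n k (Suc i)" "B \<in> UT_stage n k (Suc i)" "i < k" "k < n"
  shows "(A \<otimes>\<^bsub>UT n\<^esub> B) i k = A i k + B i k"
proof -
  have *: "A \<in> UT_carrier n" "B \<in> UT_carrier n" using assms by (simp_all add: UT_stage_def)
  have "(\<Sum>p=i..k. A i p * B p k) = (\<Sum>p\<in>{i, k}. A i p * B p k)"
    using assms by (intro sum.mono_neutral_right) (auto simp: UT_stage_def)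
  also have "\<dots> = A i k + B i k"
    using * assms(3,4) by (simp add: UT_carrier_iff)
  finally show ?thesis using * assms by (simp add: UT_mult_entry)
qed

lemma UT_stage_kernel:
  assumes "i < k"
  shows "UT_stage n k i = {A \<in> UT_stage n k (Suc i). A i k = 0}"
  using assms by (auto simp: UT_stage_def) (metis Suc_leI le_neq_implies_less)

text \<open>By centrality the commutator of two lifts depends only on the matrices below them.
  \<open>lifts_commute\<close> is therefore the abstract form of the condition that \<open>S\<close>
  contains the classes of all commuting elementary pairs.\<close>

locale UT_extension = E: group E for E (structure) and n :: nat and \<pi> +
  assumes \<pi>: "\<pi> \<in> hom E (UT n)"
    and surj: "\<pi> ` carrier E = UT_carrier n"
    and central: "\<And>z x. z \<in> carrier E \<Longrightarrow> \<pi> z = \<one>\<^bsub>UT n\<^esub> \<Longrightarrow> x \<in> carrier E \<Longrightarrow> z \<otimes> x = x \<otimes> z"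
    and lifts_commute: "\<And>x y i j k l. x \<in> carrier E \<Longrightarrow> y \<in> carrier E \<Longrightarrow> i < j \<Longrightarrow> j < n \<Longrightarrow> k < l \<Longrightarrow> l < n
      \<Longrightarrow> j \<noteq> k \<Longrightarrow> i \<noteq> l \<Longrightarrow> \<pi> x = elm n i j 1 \<Longrightarrow> \<pi> y = elm n k l 1 \<Longrightarrow> x \<otimes> y = y \<otimes> x"
begin

sublocale G: group "UT n" by (rule UT_group)
sublocale group_hom E "UT n" \<pi> by unfold_locales (rule \<pi>)

lemma \<pi>_closed [simp]: "x \<in> carrier E \<Longrightarrow> \<pi> x \<in> UT_carrier n"
  using hom_closed by simp

definition some_lift :: "nat \<Rightarrow> nat \<Rightarrow> 'a" where
  "some_lift i j = (SOME x. x \<in> carrier E \<and> \<pi> x = elm n i j 1)"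

text \<open>An arbitrary lift would satisfy the commutator relation only up to a central factor;
  taking the commutator itself as the lift removes that factor.\<close>

definition lift :: "nat \<Rightarrow> nat \<Rightarrow> 'a" where
  "lift i k = (if k = Suc i then some_lift i k
     else some_lift i (Suc i) \<otimes> some_lift (Suc i) k \<otimes> inv (some_lift (Suc i) k \<otimes> some_lift i (Suc i)))"

lemma some_lift:
  assumes "i < j"
  shows "some_lift i j \<in> carrier E" "\<pi> (some_lift i j) = elm n i j 1"
proof -
  have "elm n i j 1 \<in> \<pi> ` carrier E" using assms surj by simp
  then have "\<exists>x. x \<in> carrier E \<and> \<pi> x = elm n i j 1" by auto
  then have "some_lift i j \<in> carrier E \<and> \<pi> (some_lift i j) = elm n i j 1"
    unfolding some_lift_def by (rule someI_ex)
  then show "some_lift i j \<in> carrier E" "\<pi> (some_lift i j) = elm n i j 1" by auto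
qed

lemma lift:
  assumes "i < k" "k < n"
  shows "lift i k \<in> carrier E" "\<pi> (lift i k) = elm n i k 1"
proof -
  show "lift i k \<in> carrier E" using assms some_lift by (simp add: lift_def)
  show "\<pi> (lift i k) = elm n i k 1"
  proof (cases "k = Suc i")
    case False
    then have "elm n i (Suc i) 1 \<otimes>\<^bsub>UT n\<^esub> elm n (Suc i) k 1 \<otimes>\<^bsub>UT n\<^esub>
        inv\<^bsub>UT n\<^esub> (elm n (Suc i) k 1 \<otimes>\<^bsub>UT n\<^esub> elm n i (Suc i) 1) = elm n i k 1"
      using assms UT_commutator[of i "Suc i" k n] by (simp add: G.inv_solve_right' UT_mult_closed)
    then show ?thesis using assms False some_lift by (simp add: lift_def)
  qed (use assms some_lift in \<open>simp add: lift_def\<close>)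
qed

lemma eq_central_mult:
  assumes "x \<in> carrier E" "x' \<in> carrier E" "\<pi> x = \<pi> x'"
  obtains z where "z \<in> carrier E" "x = z \<otimes> x'" "\<And>y. y \<in> carrier E \<Longrightarrow> z \<otimes> y = y \<otimes> z"
proof
  show "x \<otimes> inv x' \<in> carrier E" "x = x \<otimes> inv x' \<otimes> x'"
    using assms by (simp_all add: E.m_assoc)
  show "x \<otimes> inv x' \<otimes> y = y \<otimes> (x \<otimes> inv x')" if "y \<in> carrier E" for y
    using that assms by (intro central) simp_all
qed

text \<open>\<open>lift i k\<close> was defined with an arbitrary lift at \<open>(Suc i, k)\<close>.
  Replacing that by \<open>lift (Suc i) k\<close> changes it by a central factor, which appears on
  both sides and cancels.\<close>

lemma lift_commutator:
  assumes "Suc i < k" "k < n"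
  shows "lift i (Suc i) \<otimes> lift (Suc i) k = lift i k \<otimes> (lift (Suc i) k \<otimes> lift i (Suc i))"
proof -
  let ?x = "some_lift i (Suc i)" and ?y = "some_lift (Suc i) k" and ?y' = "lift (Suc i) k"
  have c: "?x \<in> carrier E" "?y \<in> carrier E" "?y' \<in> carrier E" "lift i k \<in> carrier E"
    using assms some_lift lift by auto
  obtain z where z: "z \<in> carrier E" "?y' = z \<otimes> ?y" "\<And>y. y \<in> carrier E \<Longrightarrow> z \<otimes> y = y \<otimes> z"
    using eq_central_mult[OF c(3,2)] assms some_lift lift by auto
  have xz: "?x \<otimes> z = z \<otimes> ?x" and kz: "lift i k \<otimes> z = z \<otimes> lift i k" using z(3) c by auto
  have L: "?x \<otimes> ?y = lift i k \<otimes> (?y \<otimes> ?x)"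
    using assms c(1,2) by (simp add: lift_def E.m_assoc)
  have "?x \<otimes> ?y' = z \<otimes> (?x \<otimes> ?y)"
    using c z(1) by (simp add: z(2) E.m_assoc[symmetric] xz)
  also have "\<dots> = lift i k \<otimes> (?y' \<otimes> ?x)"
    using c z(1) unfolding L by (simp add: z(2) E.m_assoc[symmetric] kz)
  finally show ?thesis by (simp add: lift_def)
qed

text \<open>The prescribed values on elementary matrices are what the induction step uses. That
  \<open>s\<close> is a section is read off from them at the very end.\<close>

definition partial_split :: "nat \<Rightarrow> nat \<Rightarrow> bool" where
  "partial_split k i \<longleftrightarrow> (\<exists>s\<in>hom (UT n\<lparr>carrier := UT_stage n k i\<rparr>) E.
      \<forall>l m. l < m \<longrightarrow> m < n \<longrightarrow> m < k \<or> m = k \<and> l < i \<longrightarrow> s (elm n l m 1) = lift l m)"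

text \<open>To extend over the new generator \<open>?e\<close>, conjugation by \<open>?e\<close> and
  by \<open>?y\<close> must agree under \<open>s\<close>. The set \<open>H\<close> where they agree
  is a subgroup, so generators suffice. Elementary matrices outside column \<open>i\<close> commute
  with \<open>?e\<close>, and their lifts commute with \<open>?y\<close>; only column
  \<open>i\<close> interacts with row \<open>i\<close>.\<close>

lemma partial_split_step:
  assumes "partial_split k i" "i < k" "k < n"
  shows "partial_split k (Suc i)"
proof -
  let ?K = "UT_stage n k i" and ?K' = "UT_stage n k (Suc i)" and ?e = "elm n i k 1" and ?y = "lift i k"
  obtain s where hom: "s \<in> hom (UT n\<lparr>carrier := ?K\<rparr>) E"
    and s: "\<And>l m. l < m \<Longrightarrow> m < n \<Longrightarrow> m < k \<or> m = k \<and> l < i \<Longrightarrow> s (elm n l m 1) = lift l m"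
    using assms(1) by (auto simp: partial_split_def)
  have sc: "s g \<in> carrier E" if "g \<in> ?K" for g
    using hom that by (auto simp: hom_def)
  have sm: "s (g \<otimes>\<^bsub>UT n\<^esub> h) = s g \<otimes> s h" if "g \<in> ?K" "h \<in> ?K" for g h
    using hom that by (auto simp: hom_def)
  interpret K: subgroup ?K "UT n" using assms by (intro subgroup_UT_stage) auto
  interpret K': subgroup ?K' "UT n" using assms by (intro subgroup_UT_stage) auto
  have Kc [simp]: "g \<in> ?K \<Longrightarrow> g \<in> UT_carrier n" for g by (simp add: UT_stage_def)
  have y: "?y \<in> carrier E" and e: "?e \<in> UT_carrier n" using assms lift by auto
  have s1: "s \<one>\<^bsub>UT n\<^esub> = \<one>"
    using sm[of "\<one>\<^bsub>UT n\<^esub>" "\<one>\<^bsub>UT n\<^esub>"] sc[of "\<one>\<^bsub>UT n\<^esub>"] by simp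
  have sinv: "s (inv\<^bsub>UT n\<^esub> g) = inv s g" if "g \<in> ?K" for g
  proof -
    have "s (inv\<^bsub>UT n\<^esub> g) \<otimes> s g = \<one>"
      using sm[of "inv\<^bsub>UT n\<^esub> g" g] that s1 K.mem_carrier[OF that] by simp
    then show ?thesis using that by (intro E.inv_equality[symmetric]) (auto intro: sc)
  qed
  define H where "H = {g \<in> ?K. \<exists>g'\<in>?K. ?e \<otimes>\<^bsub>UT n\<^esub> g = g' \<otimes>\<^bsub>UT n\<^esub> ?e \<and> ?y \<otimes> s g = s g' \<otimes> ?y}"
  have H_sub: "subgroup H (UT n)"
  proof (rule G.subgroupI)
    show "H \<subseteq> carrier (UT n)" using K.subset by (auto simp: H_def)
    have "\<one>\<^bsub>UT n\<^esub> \<in> H" using e y s1 by (auto simp: H_def intro!: bexI[of _ "\<one>\<^bsub>UT n\<^esub>"])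
    then show "H \<noteq> {}" by blast
  next
    fix g assume "g \<in> H"
    then obtain g' where g: "g \<in> ?K" "g' \<in> ?K" "?e \<otimes>\<^bsub>UT n\<^esub> g = g' \<otimes>\<^bsub>UT n\<^esub> ?e" "?y \<otimes> s g = s g' \<otimes> ?y"
      by (auto simp: H_def)
    have gc: "g \<in> carrier (UT n)" "g' \<in> carrier (UT n)" using g by auto
    have 1: "?e \<otimes>\<^bsub>UT n\<^esub> inv\<^bsub>UT n\<^esub> g = inv\<^bsub>UT n\<^esub> g' \<otimes>\<^bsub>UT n\<^esub> ?e"
      using gc e g(3) by (intro G.twisted_commute_inv) auto
    have "?y \<otimes> inv (s g) = inv (s g') \<otimes> ?y"
      using sc g y by (intro E.twisted_commute_inv) auto
    then show "inv\<^bsub>UT n\<^esub> g \<in> H" using g 1 sinv by (auto simp: H_def intro!: bexI[of _ "inv\<^bsub>UT n\<^esub> g'"])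
  next
    fix g h assume "g \<in> H" "h \<in> H"
    then obtain g' h' where g: "g \<in> ?K" "g' \<in> ?K" "?e \<otimes>\<^bsub>UT n\<^esub> g = g' \<otimes>\<^bsub>UT n\<^esub> ?e" "?y \<otimes> s g = s g' \<otimes> ?y"
      and h: "h \<in> ?K" "h' \<in> ?K" "?e \<otimes>\<^bsub>UT n\<^esub> h = h' \<otimes>\<^bsub>UT n\<^esub> ?e" "?y \<otimes> s h = s h' \<otimes> ?y"
      by (auto simp: H_def)
    have gc: "g \<in> carrier (UT n)" "g' \<in> carrier (UT n)" "h \<in> carrier (UT n)" "h' \<in> carrier (UT n)"
      using g h by auto
    have "?e \<otimes>\<^bsub>UT n\<^esub> (g \<otimes>\<^bsub>UT n\<^esub> h) = g' \<otimes>\<^bsub>UT n\<^esub> (?e \<otimes>\<^bsub>UT n\<^esub> h)"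
      using gc e by (simp add: G.m_assoc[symmetric] g(3))
    also have "\<dots> = (g' \<otimes>\<^bsub>UT n\<^esub> h') \<otimes>\<^bsub>UT n\<^esub> ?e"
      using gc e by (simp add: G.m_assoc h(3))
    finally have 1: "?e \<otimes>\<^bsub>UT n\<^esub> (g \<otimes>\<^bsub>UT n\<^esub> h) = (g' \<otimes>\<^bsub>UT n\<^esub> h') \<otimes>\<^bsub>UT n\<^esub> ?e" .
    have "?y \<otimes> s (g \<otimes>\<^bsub>UT n\<^esub> h) = s g' \<otimes> (?y \<otimes> s h)"
      using sc g(1,2) h(1,2) y by (simp add: sm E.m_assoc[symmetric] g(4))
    also have "\<dots> = s (g' \<otimes>\<^bsub>UT n\<^esub> h') \<otimes> ?y"
      using sc g(1,2) h(1,2) y by (simp add: sm E.m_assoc h(4))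
    finally show "g \<otimes>\<^bsub>UT n\<^esub> h \<in> H"
      using g h 1 by (auto simp: H_def intro!: bexI[of _ "g' \<otimes>\<^bsub>UT n\<^esub> h'"])
  qed
  interpret H: subgroup H "UT n" by (rule H_sub)
  have mem: "elm n l m 1 \<in> ?K" if "l < m" "m < n" "m < k \<or> m = k \<and> l < i" for l m
    using that by (simp add: UT_stage_elm_iff)
  have comm: "elm n l m 1 \<in> H" if "l < m" "m < k \<or> m = k \<and> l < i" "m \<noteq> i" for l m
  proof -
    have lm: "m < n" using that assms by auto
    have "?e \<otimes>\<^bsub>UT n\<^esub> elm n l m 1 = elm n l m 1 \<otimes>\<^bsub>UT n\<^esub> ?e"
      using that assms lm by (intro UT_elm_commute) auto
    moreover have "?y \<otimes> lift l m = lift l m \<otimes> ?y"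
      using that assms lm by (intro lifts_commute[of _ _ i k l m] lift) auto
    ultimately show ?thesis using mem[OF that(1) lm that(2)] s[OF that(1) lm that(2)]
      by (auto simp: H_def)
  qed
  \<comment> \<open>The entry next to the diagonal in column \<open>i\<close>: here the conjugate
    differs by the inverse of the elementary matrix at \<open>(l, k)\<close>, and
    \<open>lift_commutator\<close> gives the same relation between the lifts.\<close>
  have simple: "elm n l (Suc l) 1 \<in> H" if "Suc l = i" for l
  proof -
    let ?g = "elm n l (Suc l) 1" and ?h = "elm n l k 1"
    have g: "?g \<in> ?K" "s ?g = lift l i" and h: "?h \<in> ?K" "s ?h = lift l k"
      using that assms mem s by auto
    have "?e \<otimes>\<^bsub>UT n\<^esub> ?g = inv\<^bsub>UT n\<^esub> ?h \<otimes>\<^bsub>UT n\<^esub> ?g \<otimes>\<^bsub>UT n\<^esub> ?e"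
      using UT_commutator[of l i k n] assms that
      by (simp add: G.m_assoc G.inv_solve_left UT_mult_closed)
    moreover have c: "lift l i \<in> carrier E" "lift l k \<in> carrier E" using assms that lift by auto
    then have "?y \<otimes> lift l i = inv (lift l k) \<otimes> lift l i \<otimes> ?y"
      using lift_commutator[of l k] assms that y by (simp add: E.m_assoc E.inv_solve_left)
    ultimately show ?thesis using g h sm[of "inv\<^bsub>UT n\<^esub> ?h" ?g] sinv[of ?h]
      by (auto simp: H_def intro!: bexI[of _ "inv\<^bsub>UT n\<^esub> ?h \<otimes>\<^bsub>UT n\<^esub> ?g"])
  qed
  have "?K \<subseteq> H"
  proof (rule UT_stage_subset_subgroup[OF H_sub])
    fix l m assume lm: "l < m" "m < n" "m < k \<or> m = k \<and> l < i"
    show "elm n l m 1 \<in> H"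
    proof (cases "m = i \<and> Suc l < m")
      case True
      \<comment> \<open>Higher entries of column \<open>i\<close> are commutators of a matrix in
        column \<open>i - 1\<close> and the one next to the diagonal, both already in
        \<open>H\<close>.\<close>
      then obtain m' where m': "m = Suc m'" "l < m'" by (cases m) auto
      have *: "elm n l m' 1 \<in> H" "elm n m' m 1 \<in> H"
        using True m' assms simple[of m'] by (auto intro!: comm)
      then have c: "elm n l m' 1 \<in> carrier (UT n)" "elm n m' m 1 \<in> carrier (UT n)"
        using m' by simp_all
      have "elm n l m 1 = elm n l m' 1 \<otimes>\<^bsub>UT n\<^esub> elm n m' m 1 \<otimes>\<^bsub>UT n\<^esub>
          inv\<^bsub>UT n\<^esub> (elm n m' m 1 \<otimes>\<^bsub>UT n\<^esub> elm n l m' 1)"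
        using UT_commutator[of l m' m n] m' lm c by (simp add: G.inv_solve_right UT_mult_closed)
      then show ?thesis using * by simp
    next
      case False
      then show ?thesis using comm[OF lm(1,3)] simple lm by (cases "m = i") (auto simp: not_less le_Suc_eq)
    qed
  qed (use assms in auto)
  then have conj: "\<exists>g'\<in>?K. ?e \<otimes>\<^bsub>UT n\<^esub> g = g' \<otimes>\<^bsub>UT n\<^esub> ?e \<and> ?y \<otimes> s g = s g' \<otimes> ?y" if "g \<in> ?K" for g
    using that by (auto simp: H_def)
  have "\<exists>s'\<in>hom (UT n\<lparr>carrier := ?K'\<rparr>) E. (\<forall>g\<in>?K. s' g = s g) \<and> s' ?e = ?y"
  proof (rule group.extend_hom_semidirect_int[where \<alpha>="\<lambda>A. A i k"])
    show "group (UT n\<lparr>carrier := ?K'\<rparr>)" by (rule K'.subgroup_is_group) (rule UT_group)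
    show "?K = {x \<in> carrier (UT n\<lparr>carrier := ?K'\<rparr>). x i k = 0}"
      using UT_stage_kernel[OF assms(2)] by simp
    show "?e \<in> carrier (UT n\<lparr>carrier := ?K'\<rparr>)" using assms by (simp add: UT_stage_elm_iff)
    show "?e i k = 1" using assms by (simp add: elm_def)
  qed (use assms y sc sm conj UT_stage_coordinate E.group_axioms in auto)
  then obtain s' where s': "s' \<in> hom (UT n\<lparr>carrier := ?K'\<rparr>) E" "\<And>g. g \<in> ?K \<Longrightarrow> s' g = s g" "s' ?e = ?y"
    by blast
  have "s' (elm n l m 1) = lift l m" if lm: "l < m" "m < n" "m < k \<or> m = k \<and> l < Suc i" for l m
  proof (cases "m = k \<and> l = i")
    case False
    then have "m < k \<or> m = k \<and> l < i" using lm by auto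
    then show ?thesis using lm s mem s'(2) by simp
  qed (use s' in auto)
  then show ?thesis using s'(1) unfolding partial_split_def by blast
qed

lemma splits: "\<exists>s\<in>hom (UT n) E. \<forall>g\<in>UT_carrier n. \<pi> (s g) = g"
proof -
  have "partial_split n 0"
  proof (rule UT_stage_induct[where Q=partial_split])
    have "(\<lambda>_. \<one>) \<in> hom (UT n\<lparr>carrier := UT_stage n 0 0\<rparr>) E" by (auto simp: hom_def)
    then show "partial_split 0 0" unfolding partial_split_def by blast
  next
    fix k assume "k < n" "partial_split k k"
    then show "partial_split (Suc k) 0"
      by (auto simp: partial_split_def UT_stage_diag less_Suc_eq)
  qed (rule partial_split_step)
  then obtain s where s: "s \<in> hom (UT n) E"
    "\<And>l m. l < m \<Longrightarrow> m < n \<Longrightarrow> s (elm n l m 1) = lift l m"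
  proof -
    assume *: "\<And>s. s \<in> hom (UT n) E \<Longrightarrow> (\<And>l m. l < m \<Longrightarrow> m < n \<Longrightarrow> s (elm n l m 1) = lift l m) \<Longrightarrow> thesis"
    have "UT n\<lparr>carrier := UT_stage n n 0\<rparr> = UT n"
      unfolding UT_stage_full carrier_UT[symmetric] by simp
    then show thesis using \<open>partial_split n 0\<close> * by (auto simp: partial_split_def)
  qed
  interpret s: group_hom "UT n" E s by unfold_locales (rule s(1))
  \<comment> \<open>The section property defines a subgroup, and it holds on elementary matrices
    because \<open>s\<close> takes them to \<open>lift\<close>.\<close>
  let ?H = "{g \<in> carrier (UT n). \<pi> (s g) = g}"
  have "subgroup ?H (UT n)"
    by (rule G.subgroupI) (auto intro!: exI[of _ "\<one>\<^bsub>UT n\<^esub>"] simp del: carrier_UT)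
  then have "UT_stage n n 0 \<subseteq> ?H"
    by (rule UT_stage_subset_subgroup) (use s(2) lift in auto)
  then show ?thesis using s(1) by (auto simp: UT_stage_full)
qed

end

section \<open>The commutator pairing on elementary matrices\<close>

context chain_quotient
begin

lemma swap2_mult_in:
  assumes "g \<in> carrier G" "h \<in> carrier G" "k \<in> carrier G" "g \<otimes> h = h \<otimes> g" "g \<otimes> k = k \<otimes> g"
  shows "swap2 g (h \<otimes> k) - (swap2 g h + swap2 g k) \<in> S"
  using swap2_mult[OF assms] bd by blast

lemma swap2_mult_left_in:
  assumes "g \<in> carrier G" "h \<in> carrier G" "k \<in> carrier G" "g \<otimes> k = k \<otimes> g" "h \<otimes> k = k \<otimes> h"
  shows "swap2 (g \<otimes> h) k - (swap2 g k + swap2 h k) \<in> S"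
proof -
  have "- (swap2 k (g \<otimes> h) - (swap2 k g + swap2 k h)) \<in> S"
    using assms by (intro add_subgroup_uminus[OF S] swap2_mult_in) auto
  then show ?thesis by (simp add: swap2_commute[of k] algebra_simps)
qed

lemma swap2_mult_mult_in:
  assumes c: "x \<in> carrier G" "y \<in> carrier G" "z \<in> carrier G" "w \<in> carrier G"
    and comm: "x \<otimes> z = z \<otimes> x" "x \<otimes> w = w \<otimes> x" "y \<otimes> z = z \<otimes> y" "y \<otimes> w = w \<otimes> y"
  shows "x \<otimes> y \<otimes> (z \<otimes> w) = z \<otimes> w \<otimes> (x \<otimes> y)"
    and "swap2 (x \<otimes> y) (z \<otimes> w) - (swap2 x z + swap2 x w + swap2 y z + swap2 y w) \<in> S"
proof -
  have xyz: "x \<otimes> y \<otimes> z = z \<otimes> (x \<otimes> y)" and xyw: "x \<otimes> y \<otimes> w = w \<otimes> (x \<otimes> y)"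
    using c comm by (metis m_assoc)+
  then show "x \<otimes> y \<otimes> (z \<otimes> w) = z \<otimes> w \<otimes> (x \<otimes> y)" using c by (metis m_assoc m_closed)
  have "(swap2 (x \<otimes> y) (z \<otimes> w) - (swap2 (x \<otimes> y) z + swap2 (x \<otimes> y) w))
      + ((swap2 (x \<otimes> y) z - (swap2 x z + swap2 y z)) + (swap2 (x \<otimes> y) w - (swap2 x w + swap2 y w))) \<in> S"
    using c comm xyz xyw by (intro add_subgroup_add[OF S] swap2_mult_in swap2_mult_left_in) auto
  then show "swap2 (x \<otimes> y) (z \<otimes> w) - (swap2 x z + swap2 x w + swap2 y z + swap2 y w) \<in> S"
    by (simp add: algebra_simps)
qed

lemma swap2_conj_in:
  assumes "g \<in> carrier G" "h \<in> carrier G" "g' \<in> carrier G" "h' \<in> carrier G" "k \<in> carrier G"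
    and "k \<otimes> g = g' \<otimes> k" "k \<otimes> h = h' \<otimes> k" "g \<otimes> h = h \<otimes> g" "g' \<otimes> h' = h' \<otimes> g'"
  shows "swap2 g h - swap2 g' h' \<in> S"
  using swap2_conj[OF assms] bd by blast

text \<open>Modulo \<open>S\<close>, \<open>swap2 g\<close> is a homomorphism from the centraliser
  of \<open>g\<close> to an abelian group, so it kills the commutator \<open>z\<close> of
  \<open>h\<close> and \<open>k\<close>.\<close>

lemma swap2_commutator_in:
  assumes c: "g \<in> carrier G" "h \<in> carrier G" "k \<in> carrier G" "z \<in> carrier G"
    and z: "h \<otimes> k = z \<otimes> (k \<otimes> h)"
    and gh: "g \<otimes> h = h \<otimes> g" and gk: "g \<otimes> k = k \<otimes> g" and gz: "g \<otimes> z = z \<otimes> g"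
  shows "swap2 g z \<in> S"
proof -
  have gkh: "g \<otimes> (k \<otimes> h) = k \<otimes> h \<otimes> g" using c gh gk by (metis m_assoc)
  have "(swap2 g (h \<otimes> k) - (swap2 g h + swap2 g k)) - (swap2 g (k \<otimes> h) - (swap2 g k + swap2 g h))
      - (swap2 g (z \<otimes> (k \<otimes> h)) - (swap2 g z + swap2 g (k \<otimes> h))) \<in> S"
    using c gh gk gz gkh by (intro add_subgroup_diff[OF S] swap2_mult_in) auto
  then show ?thesis by (simp add: z)
qed

text \<open>Conjugation by \<open>k\<close> replaces \<open>x\<close> by
  \<open>y \<otimes> x\<close> and \<open>z\<close> by \<open>w \<otimes> z\<close>. Expand the new
  pair bimultiplicatively; invariance cancels \<open>swap2 x z\<close> and leaves the three other
  terms.\<close>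

lemma swap2_conj_expand:
  assumes c: "x \<in> carrier G" "y \<in> carrier G" "z \<in> carrier G" "w \<in> carrier G" "k \<in> carrier G"
    and comm: "x \<otimes> z = z \<otimes> x" "x \<otimes> w = w \<otimes> x" "y \<otimes> z = z \<otimes> y" "y \<otimes> w = w \<otimes> y"
    and k: "k \<otimes> x = y \<otimes> (x \<otimes> k)" "k \<otimes> z = w \<otimes> (z \<otimes> k)"
  shows "swap2 x w + swap2 y z + swap2 y w \<in> S"
proof -
  note m = swap2_mult_mult_in[of y x w z]
  have "k \<otimes> x = y \<otimes> x \<otimes> k" "k \<otimes> z = w \<otimes> z \<otimes> k" using c k by (simp_all add: m_assoc)
  then have "swap2 x z - swap2 (y \<otimes> x) (w \<otimes> z) \<in> S"
    using c comm by (intro swap2_conj_in[of x z _ _ k] m(1)) auto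
  moreover have "swap2 (y \<otimes> x) (w \<otimes> z) - (swap2 y w + swap2 y z + swap2 x w + swap2 x z) \<in> S"
    using c comm by (intro m) auto
  ultimately have "(swap2 x z - swap2 (y \<otimes> x) (w \<otimes> z)) +
      (swap2 (y \<otimes> x) (w \<otimes> z) - (swap2 y w + swap2 y z + swap2 x w + swap2 x z)) \<in> S"
    by (rule add_subgroup_add[OF S])
  then have "- (swap2 x w + swap2 y z + swap2 y w) \<in> S" by (simp add: algebra_simps)
  from add_subgroup_uminus[OF S this] show ?thesis by (simp only: minus_minus)
qed

text \<open>For commutators with \<open>k\<close> on the right, it is conjugation by
  \<open>inv k\<close> that multiplies \<open>x\<close> by \<open>y\<close> and \<open>z\<close> by
  \<open>w\<close>, since \<open>y\<close> and \<open>w\<close> commute with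
  \<open>k\<close>.\<close>

lemma swap2_conj_expand':
  assumes c: "x \<in> carrier G" "y \<in> carrier G" "z \<in> carrier G" "w \<in> carrier G" "k \<in> carrier G"
    and comm: "x \<otimes> z = z \<otimes> x" "x \<otimes> w = w \<otimes> x" "y \<otimes> z = z \<otimes> y" "y \<otimes> w = w \<otimes> y"
    and comm': "y \<otimes> x = x \<otimes> y" "w \<otimes> z = z \<otimes> w" "y \<otimes> k = k \<otimes> y" "w \<otimes> k = k \<otimes> w"
    and k: "x \<otimes> k = y \<otimes> (k \<otimes> x)" "z \<otimes> k = w \<otimes> (k \<otimes> z)"
  shows "swap2 x w + swap2 y z + swap2 y w \<in> S"
proof -
  have *: "inv k \<otimes> u = v \<otimes> (u \<otimes> inv k)"
    if "u \<in> carrier G" "v \<in> carrier G" "v \<otimes> u = u \<otimes> v" "v \<otimes> k = k \<otimes> v" "u \<otimes> k = v \<otimes> (k \<otimes> u)" for u v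
  proof -
    have "u \<otimes> k = k \<otimes> (v \<otimes> u)" using that c(5) by (metis m_assoc)
    then have "inv k \<otimes> (u \<otimes> k) \<otimes> inv k = inv k \<otimes> (k \<otimes> (v \<otimes> u)) \<otimes> inv k" by simp
    moreover have "inv k \<otimes> (k \<otimes> (v \<otimes> u)) = v \<otimes> u" using that c(5) by (simp add: m_assoc[symmetric])
    ultimately show ?thesis using that(1,2) c(5) by (simp add: m_assoc)
  qed
  show ?thesis using c comm comm' k by (intro swap2_conj_expand[of x y z w "inv k"] *) auto
qed

end

locale UT_chain_quotient = chain_quotient "UT n" S for n S
begin

abbreviation e where "e i j \<equiv> elm n i j 1"

text \<open>Through the interior index \<open>m\<close>, \<open>e k l\<close> is the commutator of
  \<open>e k m\<close> and \<open>e m l\<close>. Both commute with \<open>e i j\<close> because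
  \<open>m\<close> avoids \<open>i\<close> and \<open>j\<close>.\<close>

lemma swap2_elm_inner_right:
  assumes "i < j" "j < n" "k < m" "m < l" "l < n" "j \<noteq> k" "i \<noteq> l" "m \<noteq> i" "m \<noteq> j"
  shows "swap2 (e i j) (e k l) \<in> S"
  using assms
  by (intro swap2_commutator_in[of _ "e k m" "e m l"] UT_commutator UT_elm_commute) auto

lemma swap2_elm_inner_left:
  assumes "i < m" "m < j" "j < n" "k < l" "l < n" "j \<noteq> k" "i \<noteq> l" "m \<noteq> k" "m \<noteq> l"
  shows "swap2 (e i j) (e k l) \<in> S"
  using add_subgroup_uminus[OF S swap2_elm_inner_right[of k l i m j]] assms
  by (simp add: swap2_commute[of "e i j"])

text \<open>Conjugate the pair \<open>(e b c, e a c)\<close> by \<open>e c d\<close>, respectively \<open>(e b c, e b d)\<close> by \<open>e a b\<close>.\<close>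

lemma swap2_elm_conj:
  assumes "a < b" "b < c" "c < d" "d < n"
  shows "swap2 (e b c) (e a d) - swap2 (e a c) (e b d) \<in> S"
    and "swap2 (e b c) (e a d) + swap2 (e a c) (e b d) \<in> S"
proof -
  \<comment> \<open>These are the last of the three terms in each expansion below; the interior
    indices \<open>c\<close> and \<open>b\<close> of \<open>e a d\<close> make them vanish.\<close>
  have 1: "swap2 (e b d) (e a d) \<in> S" and 2: "swap2 (e a c) (e a d) \<in> S"
    using assms swap2_elm_inner_right[of b d a c d] swap2_elm_inner_right[of a c a b d] by auto
  have "swap2 (e b c) (e a d) + swap2 (e b d) (e a c) + swap2 (e b d) (e a d) \<in> S"
    using assms by (intro swap2_conj_expand'[where k="e c d"] UT_commutator UT_elm_commute) auto
  from add_subgroup_diff[OF S this 1] show "swap2 (e b c) (e a d) - swap2 (e a c) (e b d) \<in> S"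
    by (simp add: swap2_commute[of "e b d"])
  have "swap2 (e b c) (e a d) + swap2 (e a c) (e b d) + swap2 (e a c) (e a d) \<in> S"
    using assms by (intro swap2_conj_expand[where k="e a b"] UT_commutator UT_elm_commute) auto
  from add_subgroup_diff[OF S this 2] show "swap2 (e b c) (e a d) + swap2 (e a c) (e b d) \<in> S"
    by simp
qed

lemma two_swap2_elm:
  assumes "a < b" "b < c" "c < d" "d < n"
  shows "swap2 (e a c) (e b d) + swap2 (e a c) (e b d) \<in> S"
  using add_subgroup_diff[OF S swap2_elm_conj(2,1)[OF assms]] by simp

lemma swap2_elm_sym: "swap2 (e k l) (e i j) \<in> S \<Longrightarrow> swap2 (e i j) (e k l) \<in> S"
  using add_subgroup_uminus[OF S] swap2_commute by metis

text \<open>View \<open>e i j\<close> as the interval from \<open>i\<close> to \<open>j\<close>. A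
  pair is trivial as soon as one interval has an interior index that is not an endpoint of the
  other. The surviving pairs have length at most 3: two disjoint simple ones, a simple one at either
  end of an interval of length 2, two intervals of length 2 shifted by one, and a simple one in the
  middle of an interval of length 3.\<close>

lemma swap2_elm_in:
  assumes r1: "\<And>i j. Suc (Suc i) \<le> j \<Longrightarrow> Suc j < n \<Longrightarrow> swap2 (e i (Suc i)) (e j (Suc j)) \<in> S"
    and r2: "\<And>i. Suc (Suc i) < n \<Longrightarrow> swap2 (e i (Suc i)) (e i (Suc (Suc i))) \<in> S"
    and r3: "\<And>i. Suc (Suc i) < n \<Longrightarrow> swap2 (e i (Suc (Suc i))) (e (Suc i) (Suc (Suc i))) \<in> S"
    and r4: "\<And>i. Suc (Suc (Suc i)) < n \<Longrightarrow> swap2 (e i (Suc (Suc i))) (e (Suc i) (Suc (Suc (Suc i)))) \<in> S"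
    and ij: "i < j" "j < n" and kl: "k < l" "l < n" and ne: "j \<noteq> k" "i \<noteq> l"
  shows "swap2 (e i j) (e k l) \<in> S"
proof -
  \<comment> \<open>The middle case is conjugate to the shifted case \<open>r4\<close>, so it needs
    no relator of its own.\<close>
  have r5: "swap2 (e (Suc a) (Suc (Suc a))) (e a (Suc (Suc (Suc a)))) \<in> S" if "Suc (Suc (Suc a)) < n" for a
    using add_subgroup_add[OF S swap2_elm_conj(1)[of a "Suc a" "Suc (Suc a)" "Suc (Suc (Suc a))"] r4[of a]] that
    by simp
  have one: "swap2 (e i (Suc i)) (e k l) \<in> S"
    if "k < l" "l < n" "Suc i < n" "Suc i \<noteq> k" "i \<noteq> l" for i k l
  proof -
    consider m where "k < m" "m < l" "m \<noteq> i" "m \<noteq> Suc i" | "\<And>m. k < m \<Longrightarrow> m < l \<Longrightarrow> m = i \<or> m = Suc i"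
      by blast
    then show ?thesis
    proof cases
      case 1
      then show ?thesis using that swap2_elm_inner_right by auto
    next
      case 2
      have "l = Suc k \<or> l = Suc (Suc k) \<and> (k = i \<or> Suc k = i) \<or> l = Suc (Suc (Suc k)) \<and> Suc k = i"
      proof -
        consider "l = Suc k" | "l = Suc (Suc k)" | "l = Suc (Suc (Suc k))" | "Suc (Suc (Suc k)) < l"
          using \<open>k < l\<close> by linarith
        then show ?thesis
          using 2[of "Suc k"] 2[of "Suc (Suc k)"] 2[of "Suc (Suc (Suc k))"] by cases auto
      qed
      moreover have "i = k \<or> Suc (Suc i) \<le> k \<or> Suc (Suc k) \<le> i" if "l = Suc k"
        using that \<open>Suc i \<noteq> k\<close> \<open>i \<noteq> l\<close> by linarith
      ultimately show ?thesis using that r1[of i k] r1[of k i, THEN swap2_elm_sym] r2[of i]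
          r3[of k, THEN swap2_elm_sym] r5[of k] add_subgroup_0[OF S]
        by auto
    qed
  qed
  show ?thesis
  proof (cases "j = Suc i \<or> l = Suc k")
    case True
    then show ?thesis using one[of k l i] one[of i j k, THEN swap2_elm_sym] ij kl ne by auto
  next
    case False
    consider m where "k < m" "m < l" "m \<noteq> i" "m \<noteq> j" | m where "i < m" "m < j" "m \<noteq> k" "m \<noteq> l"
      | "\<And>m. k < m \<Longrightarrow> m < l \<Longrightarrow> m = i \<or> m = j" "\<And>m. i < m \<Longrightarrow> m < j \<Longrightarrow> m = k \<or> m = l"
      by blast
    then show ?thesis
    proof cases
      case 1
      then show ?thesis using swap2_elm_inner_right ij kl ne by auto
    next
      case 2
      then show ?thesis using swap2_elm_inner_left ij kl ne by auto
    next
      case 3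
      \<comment> \<open>With no usable interior index and neither interval simple, both have length
        2 and are shifted by one.\<close>
      have "Suc k = i \<and> l = Suc i \<and> j = Suc l \<or> Suc i = k \<and> j = Suc k \<and> l = Suc j"
      proof -
        have "Suc k < l" "Suc i < j" using ij kl False by auto
        then have "Suc k = i \<or> Suc k = j" "Suc i = k \<or> Suc i = l"
          using 3(1)[of "Suc k"] 3(2)[of "Suc i"] by auto
        then consider "Suc k = i" "l = Suc i" | "Suc i = k" "j = Suc k"
          using \<open>Suc k < l\<close> \<open>Suc i < j\<close> by auto
        then show ?thesis
        proof cases
          case 1
          then have "\<not> Suc l < j" using 3(2)[of "Suc l"] by auto
          then show ?thesis using 1 \<open>Suc i < j\<close> by linarith
        next
          case 2
          then have "\<not> Suc j < l" using 3(1)[of "Suc j"] by auto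
          then show ?thesis using 2 \<open>Suc k < l\<close> by linarith
        qed
      qed
      then show ?thesis using r4[of i] r4[of k, THEN swap2_elm_sym] ij kl by auto
    qed
  qed
qed

lemma cycles2_subset:
  assumes "\<And>i j k l. i < j \<Longrightarrow> j < n \<Longrightarrow> k < l \<Longrightarrow> l < n \<Longrightarrow> j \<noteq> k \<Longrightarrow> i \<noteq> l \<Longrightarrow> swap2 (e i j) (e k l) \<in> S"
  shows "cycles2 (UT n) \<subseteq> S"
proof -
  interpret X: UT_extension "cocycle_ext (UT n) S" n snd
  proof (intro UT_extension.intro UT_extension_axioms.intro group_cocycle_ext)
    show "snd \<in> hom (cocycle_ext (UT n) S) (UT n)" by (auto simp: hom_def)
    show "snd ` carrier (cocycle_ext (UT n) S) = UT_carrier n"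
    proof -
      have "g \<in> snd ` carrier (cocycle_ext (UT n) S)" if "g \<in> UT_carrier n" for g
        by (rule image_eqI[of _ _ "(coset_rep S 0, g)"]) (use that in \<open>auto simp: coset_rep_simps[OF S]\<close>)
      then show ?thesis by auto
    qed
  next
    fix z x assume zx: "z \<in> carrier (cocycle_ext (UT n) S)" "snd z = \<one>\<^bsub>UT n\<^esub>" "x \<in> carrier (cocycle_ext (UT n) S)"
    then have x: "snd x \<in> carrier (UT n)" by auto
    \<comment> \<open>Elements over the identity are central since \<open>[\<one>|g]\<close> and
      \<open>[g|\<one>]\<close> both agree with \<open>[\<one>|\<one>]\<close> modulo
      \<open>S\<close>.\<close>
    have "swap2 (snd z) (snd x) \<in> S"
      using add_subgroup_diff[OF S cocycle_one(1,2)[OF x]] zx by (simp add: swap2_def)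
    then show "z \<otimes>\<^bsub>cocycle_ext (UT n) S\<^esub> x = x \<otimes>\<^bsub>cocycle_ext (UT n) S\<^esub> z"
      using zx x by (intro cocycle_ext_commute) auto
  next
    fix x y i j k l
    assume *: "x \<in> carrier (cocycle_ext (UT n) S)" "y \<in> carrier (cocycle_ext (UT n) S)"
      "i < j" "j < n" "k < l" "l < n" "j \<noteq> k" "i \<noteq> l" "snd x = e i j" "snd y = e k l"
    then show "x \<otimes>\<^bsub>cocycle_ext (UT n) S\<^esub> y = y \<otimes>\<^bsub>cocycle_ext (UT n) S\<^esub> x"
      using assms UT_elm_commute[of i j n k l] by (intro cocycle_ext_commute) auto
  qed
  show ?thesis using X.splits cycles2_subset_if_split by auto
qed

end

section \<open>Dual cocycles\<close>

text \<open>\<open>frag_extend\<close> takes values in free abelian groups; the one on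
  \<open>unit\<close> is a copy of the integers, read off at \<open>()\<close>.\<close>

definition cochain_eval :: "('a \<Rightarrow> 'a \<Rightarrow> int) \<Rightarrow> ('a list \<Rightarrow>\<^sub>0 int) \<Rightarrow> int" where
  "cochain_eval f c = Poly_Mapping.lookup (frag_extend (\<lambda>xs. frag_cmul (f (xs!0) (xs!1)) (frag_of ())) c) ()"

lemma cochain_eval_0 [simp]: "cochain_eval f 0 = 0"
  by (simp add: cochain_eval_def)

lemma cochain_eval_diff: "cochain_eval f (a - b) = cochain_eval f a - cochain_eval f b"
  by (simp add: cochain_eval_def frag_extend_diff lookup_minus)

lemma cochain_eval_add: "cochain_eval f (a + b) = cochain_eval f a + cochain_eval f b"
  by (simp add: cochain_eval_def frag_extend_add lookup_add)

lemma cochain_eval_cmul: "cochain_eval f (frag_cmul z a) = z * cochain_eval f a"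
  by (simp add: cochain_eval_def frag_extend_cmul)

lemma cochain_eval_sum: "cochain_eval f (sum c I) = (\<Sum>i\<in>I. cochain_eval f (c i))"
  by (induction I rule: infinite_finite_induct) (auto simp: cochain_eval_add)

lemma cochain_eval_frag [simp]: "cochain_eval f (frag_of [g, h]) = f g h"
  by (simp add: cochain_eval_def)

lemma cochain_eval_swap2 [simp]: "cochain_eval f (swap2 g h) = f g h - f h g"
  by (simp add: swap2_def cochain_eval_diff)

text \<open>Taking \<open>m = 0\<close> treats integral cocycles, as 0 divides only 0, and
  \<open>m = 2\<close> the cocycles modulo 2.\<close>

lemma cochain_eval_boundaries2:
  assumes "\<And>x y z. x \<in> carrier G \<Longrightarrow> y \<in> carrier G \<Longrightarrow> z \<in> carrier G
      \<Longrightarrow> m dvd f y z - f (x \<otimes>\<^bsub>G\<^esub> y) z + f x (y \<otimes>\<^bsub>G\<^esub> z) - f x y"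
    and "b \<in> boundaries2 G"
  shows "m dvd cochain_eval f b"
proof -
  have "boundaries2 G \<subseteq> {c. m dvd cochain_eval f c}"
    by (rule boundaries2_subset)
      (auto simp: add_subgroup_def cochain_eval_diff cochain_eval_add assms(1))
  then show ?thesis using assms(2) by blast
qed

text \<open>The binomial coefficient \<open>x\<close> over 2, for negative \<open>x\<close> too. By
  \<open>tri_add\<close> it bounds, up to sign, the product of a homomorphism to the integers with
  itself.\<close>

definition tri :: "int \<Rightarrow> int" where
  "tri x = x * (x - 1) div 2"

lemma tri_0 [simp]: "tri 0 = 0" and tri_1 [simp]: "tri 1 = 0"
  by (simp_all add: tri_def)

lemma tri_add: "tri (x + y) = tri x + tri y + x * y"
proof -
  have *: "2 * tri z = z * (z - 1)" for z
    unfolding tri_def by (rule dvd_mult_div_cancel) simp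
  have "2 * tri (x + y) = 2 * (tri x + tri y + x * y)"
    using *[of "x + y"] *[of x] *[of y] by (simp add: algebra_simps)
  then show ?thesis by simp
qed

lemma UT_entries:
  assumes A: "A \<in> UT_carrier n" and B: "B \<in> UT_carrier n"
  shows "Suc i < n \<Longrightarrow> (A \<otimes>\<^bsub>UT n\<^esub> B) i (Suc i) = A i (Suc i) + B i (Suc i)"
    and "Suc (Suc i) < n \<Longrightarrow> (A \<otimes>\<^bsub>UT n\<^esub> B) i (Suc (Suc i)) =
      A i (Suc (Suc i)) + B i (Suc (Suc i)) + A i (Suc i) * B (Suc i) (Suc (Suc i))"
    and "Suc (Suc (Suc i)) < n \<Longrightarrow> (A \<otimes>\<^bsub>UT n\<^esub> B) i (Suc (Suc (Suc i))) =
      A i (Suc (Suc (Suc i))) + B i (Suc (Suc (Suc i)))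
      + A i (Suc i) * B (Suc i) (Suc (Suc (Suc i))) + A i (Suc (Suc i)) * B (Suc (Suc i)) (Suc (Suc (Suc i)))"
proof -
  have d: "k < n \<Longrightarrow> A k k = 1" "k < n \<Longrightarrow> B k k = 1" for k
    using A B by (simp_all add: UT_carrier_iff)
  show "Suc i < n \<Longrightarrow> (A \<otimes>\<^bsub>UT n\<^esub> B) i (Suc i) = A i (Suc i) + B i (Suc i)"
    using A B d by (simp add: UT_mult_entry)
  show "Suc (Suc i) < n \<Longrightarrow> (A \<otimes>\<^bsub>UT n\<^esub> B) i (Suc (Suc i)) =
      A i (Suc (Suc i)) + B i (Suc (Suc i)) + A i (Suc i) * B (Suc i) (Suc (Suc i))"
    using A B d by (simp add: UT_mult_entry)
  show "Suc (Suc (Suc i)) < n \<Longrightarrow> (A \<otimes>\<^bsub>UT n\<^esub> B) i (Suc (Suc (Suc i))) =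
      A i (Suc (Suc (Suc i))) + B i (Suc (Suc (Suc i)))
      + A i (Suc i) * B (Suc i) (Suc (Suc (Suc i))) + A i (Suc (Suc i)) * B (Suc (Suc i)) (Suc (Suc (Suc i)))"
    using A B d by (simp add: UT_mult_entry)
qed

text \<open>The index \<open>(i, j)\<close> encodes a relator, with \<open>x\<^sub>i\<close> the elementary matrix at \<open>(i, i + 1)\<close>:
  \<open>(i, i)\<close> stands for \<open>[[x\<^sub>i, x\<^sub>i\<^sub>+\<^sub>1], [x\<^sub>i\<^sub>+\<^sub>1, x\<^sub>i\<^sub>+\<^sub>2]]\<close>, \<open>(i, i + 1)\<close> for \<open>[x\<^sub>i, [x\<^sub>i, x\<^sub>i\<^sub>+\<^sub>1]]\<close>, \<open>(i + 1, i)\<close> for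
  \<open>[[x\<^sub>i, x\<^sub>i\<^sub>+\<^sub>1], x\<^sub>i\<^sub>+\<^sub>1]\<close>, and any other pair for \<open>[x\<^sub>i, x\<^sub>j]\<close>. On \<open>(i, i)\<close> the dual cochain is a cocycle only
  modulo 2.\<close>

definition dual_cocycle :: "nat \<times> nat \<Rightarrow> (nat \<Rightarrow> nat \<Rightarrow> int) \<Rightarrow> (nat \<Rightarrow> nat \<Rightarrow> int) \<Rightarrow> int" where
  "dual_cocycle p A B = (let i = fst p; j = snd p; k = Suc (Suc i) in
     if i = j then
       A i k * B (Suc i) (Suc k) + A i (Suc i) * B (Suc i) (Suc k) + A (Suc i) k * B i (Suc k)
       + A (Suc i) k * A i k * B k (Suc k) + A i (Suc i) * A (Suc i) k * B (Suc i) (Suc k)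
     else if j = Suc i then A i j * B i (Suc j) + tri (A i j) * B j (Suc j)
     else if i = Suc j then A j (Suc i) * B i (Suc i) + A j i * tri (B i (Suc i))
     else A i (Suc i) * B j (Suc j))"

definition relator :: "nat \<Rightarrow> nat \<times> nat \<Rightarrow> (nat \<Rightarrow> nat \<Rightarrow> int) list \<Rightarrow>\<^sub>0 int" where
  "relator n p = (let i = fst p; j = snd p in
     if i = j then swap2 (elm n i (Suc (Suc i)) 1) (elm n (Suc i) (Suc (Suc (Suc i))) 1)
     else if j = Suc i then swap2 (elm n i (Suc i) 1) (elm n i (Suc (Suc i)) 1)
     else if i = Suc j then swap2 (elm n j (Suc (Suc j)) 1) (elm n i (Suc i) 1)
     else swap2 (elm n i (Suc i) 1) (elm n j (Suc j) 1))"

definition torsion_index :: "nat \<Rightarrow> (nat \<times> nat) set" where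
  "torsion_index n = {(i, j). i = j \<and> Suc (Suc (Suc i)) < n}"

definition free_index :: "nat \<Rightarrow> (nat \<times> nat) set" where
  "free_index n = {(i, j). Suc i < n \<and> Suc j < n \<and> (i < j \<or> i = Suc j)}"

lemma elm_above_diagonal: "a < b \<Longrightarrow> b < n \<Longrightarrow> elm n i j z a b = (if a = i \<and> b = j then z else 0)"
  by (simp add: elm_def)

lemma cochain_eval_relator:
  assumes "p \<in> torsion_index n \<union> free_index n" "q \<in> torsion_index n \<union> free_index n"
  shows "cochain_eval (dual_cocycle p) (relator n q) = (if p = q then 1 else 0)"
  using assms
  by (cases p; cases q)
    (auto simp: torsion_index_def free_index_def dual_cocycle_def relator_def Let_def elm_above_diagonal)

text \<open>Let \<open>a\<close>, \<open>b\<close> be adjacent superdiagonal entries and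
  \<open>u\<close> the entry that they span. By matrix multiplication the coboundary of
  \<open>u\<close> is \<open>-a b\<close>, and that of \<open>tri a\<close> is \<open>-a a\<close>;
  hence \<open>a u + tri(a) b\<close> and \<open>u b + a tri(b)\<close> are the Massey products of
  \<open>a, a, b\<close> and \<open>a, b, b\<close>. For other pairs the cocycle is a cup product of
  homomorphisms.\<close>

lemma dual_cocycle_free:
  assumes p: "p \<in> free_index n" and xyz: "x \<in> UT_carrier n" "y \<in> UT_carrier n" "z \<in> UT_carrier n"
  shows "dual_cocycle p y z - dual_cocycle p (x \<otimes>\<^bsub>UT n\<^esub> y) z + dual_cocycle p x (y \<otimes>\<^bsub>UT n\<^esub> z) - dual_cocycle p x y = 0"
  using p xyz
  by (cases p) (auto simp: free_index_def dual_cocycle_def Let_def UT_entries tri_add algebra_simps)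

lemma dual_cocycle_torsion:
  assumes p: "p \<in> torsion_index n" and xyz: "x \<in> UT_carrier n" "y \<in> UT_carrier n" "z \<in> UT_carrier n"
  shows "2 dvd dual_cocycle p y z - dual_cocycle p (x \<otimes>\<^bsub>UT n\<^esub> y) z + dual_cocycle p x (y \<otimes>\<^bsub>UT n\<^esub> z) - dual_cocycle p x y"
proof -
  obtain i where i: "p = (i, i)" "Suc (Suc (Suc i)) < n" using p by (auto simp: torsion_index_def)
  let ?j = "Suc i" and ?k = "Suc (Suc i)" and ?l = "Suc (Suc (Suc i))"
  \<comment> \<open>Let \<open>a\<close>, \<open>b\<close>, \<open>c\<close> be the superdiagonal
    entries of the block, \<open>u\<close> and \<open>v\<close> those at \<open>(i, ?k)\<close> and
    \<open>(?j, ?l)\<close>. The coboundary of \<open>u v\<close> is \<open>u b c - a b v\<close>.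
    The terms with \<open>(i, ?l)\<close> and the pointwise products turn it into
    \<open>-2 a b v - a b^2 c\<close>, and \<open>a v\<close> adds \<open>a b c\<close>. What is
    left is even because \<open>b (b - 1)\<close> is.\<close>
  have "dual_cocycle p y z - dual_cocycle p (x \<otimes>\<^bsub>UT n\<^esub> y) z + dual_cocycle p x (y \<otimes>\<^bsub>UT n\<^esub> z) - dual_cocycle p x y
    = - (2 * (x i ?j * y ?j ?k * z ?j ?l)) - x i ?j * (y ?j ?k * (y ?j ?k - 1)) * z ?k ?l"
    using i xyz by (simp add: dual_cocycle_def Let_def UT_entries algebra_simps)
  also have "2 dvd \<dots>" by simp
  finally show ?thesis .
qed

section \<open>Integer combinations and the size of the index set\<close>

lemma add_subgroup_cmul:
  fixes S :: "('a \<Rightarrow>\<^sub>0 int) set"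
  assumes S: "add_subgroup S" and x: "x \<in> S"
  shows "frag_cmul z x \<in> S"
proof -
  have nat: "frag_cmul (int m) x \<in> S" for m
    by (induction m) (use x in \<open>auto simp: frag_cmul_distrib add_subgroup_0[OF S] add_subgroup_add[OF S]\<close>)
  show ?thesis
  proof (cases z rule: int_cases2)
    case (nonpos m)
    then show ?thesis using add_subgroup_uminus[OF S nat[of m]] by simp
  qed (simp add: nat)
qed

lemma add_subgroup_sum: "add_subgroup S \<Longrightarrow> (\<And>i. i \<in> I \<Longrightarrow> f i \<in> S) \<Longrightarrow> sum f I \<in> S"
  by (induction I rule: infinite_finite_induct) (auto simp: add_subgroup_0 add_subgroup_add)

lemma finite_torsion_index: "finite (torsion_index n)"
  by (rule finite_subset[of _ "{..<n} \<times> {..<n}"]) (auto simp: torsion_index_def)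

lemma finite_free_index: "finite (free_index n)"
  by (rule finite_subset[of _ "{..<n} \<times> {..<n}"]) (auto simp: free_index_def)

lemma torsion_free_disjoint: "torsion_index n \<inter> free_index n = {}"
  by (auto simp: torsion_index_def free_index_def)

lemma card_free_index:
  assumes "n \<ge> 3"
  shows "card (free_index n) = (n + 1) * (n - 2) div 2"
proof -
  have "2 * card (free_index (Suc (Suc m))) = m * (m + 3)" for m
  proof (induction m)
    case 0
    have "free_index (Suc (Suc 0)) = {}" by (auto simp: free_index_def)
    then show ?case by simp
  next
    case (Suc m)
    let ?m = "Suc m"
    \<comment> \<open>One more generator \<open>?m\<close> contributes its pairs with all earlier
      ones and the second Heisenberg relator with its neighbour \<open>m\<close>.\<close>
    let ?N = "(\<lambda>i. (i, ?m)) ` {..<?m} \<union> {(?m, m)}"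
    have "free_index (Suc (Suc ?m)) = free_index (Suc ?m) \<union> ?N"
      by (auto simp: free_index_def less_Suc_eq)
    moreover have "card (free_index (Suc ?m) \<union> ?N) = card (free_index (Suc ?m)) + card ?N"
      by (rule card_Un_disjoint) (auto simp: finite_free_index, auto simp: free_index_def)
    moreover have "card ?N = Suc ?m"
      by (subst card_Un_disjoint) (auto simp: card_image inj_on_def)
    ultimately have "card (free_index (Suc (Suc ?m))) = card (free_index (Suc ?m)) + Suc ?m"
      by simp
    then show ?case using Suc by (simp add: algebra_simps)
  qed
  moreover have "Suc (Suc (n - 2)) = n" "n - 2 + 3 = n + 1" using assms by simp_all
  ultimately have "2 * card (free_index n) = (n - 2) * (n + 1)" by metis
  then show ?thesis by (simp add: mult.commute)
qed

section \<open>The Schur multiplier\<close>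

context
  fixes n :: nat and I T :: "(nat \<times> nat) set"
  defines "T \<equiv> torsion_index n" and "I \<equiv> torsion_index n \<union> free_index n"
begin

interpretation G: group "UT n" by (rule UT_group)

lemma finite_index: "finite I"
  by (simp add: I_def finite_torsion_index finite_free_index)

lemma relator_in_chains: "relator n p \<in> carrier (chains (UT n) 2)"
proof -
  have *: "swap2 (elm n i j 1) (elm n k l 1) \<in> carrier (chains (UT n) 2)"
    if "i < j" "k < l" for i j k l
  proof -
    have "Poly_Mapping.keys (swap2 (elm n i j 1) (elm n k l 1)) \<subseteq>
        {[elm n i j 1, elm n k l 1], [elm n k l 1, elm n i j 1]}"
      using keys_diff[of "frag_of [elm n i j 1, elm n k l 1]" "frag_of [elm n k l 1, elm n i j 1]"]
      by (auto simp: swap2_def)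
    also have "\<dots> \<subseteq> {xs. length xs = 2 \<and> set xs \<subseteq> UT_carrier n}" using that by auto
    finally show ?thesis by simp
  qed
  show ?thesis by (auto simp: relator_def Let_def simp del: carrier_chains intro!: * )
qed

lemma relator_cycle: "relator n p \<in> cycles2 (UT n)" if "p \<in> I" for p
proof -
  have *: "bd2 (UT n) (swap2 (elm n i j 1) (elm n k l 1)) = 0"
    if "i < j" "j < n" "k < l" "l < n" "j \<noteq> k" "i \<noteq> l" for i j k l
    using UT_elm_commute[OF that] by (simp add: swap2_def bd2_diff)
  have "bd2 (UT n) (relator n p) = 0"
    using that by (cases p) (auto simp: I_def torsion_index_def free_index_def relator_def Let_def intro!: * )
  then show ?thesis using relator_in_chains by (simp add: cycles2_def del: carrier_chains)
qed

lemma two_relator: "frag_cmul 2 (relator n p) \<in> boundaries2 (UT n)" if p: "p \<in> T"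
proof -
  interpret UT_chain_quotient n "boundaries2 (UT n)"
    by unfold_locales (auto simp: boundaries2_add_subgroup)
  obtain i where i: "p = (i, i)" "Suc (Suc (Suc i)) < n" using p by (auto simp: T_def torsion_index_def)
  then show ?thesis
    using two_swap2_elm[of i "Suc i" "Suc (Suc i)" "Suc (Suc (Suc i))"] frag_cmul_distrib[of 1 1 "relator n p"]
    by (simp add: relator_def Let_def)
qed

lemma boundary_even:
  assumes "b \<in> boundaries2 (UT n)" "p \<in> I"
  shows "if p \<in> T then even (cochain_eval (dual_cocycle p) b) else cochain_eval (dual_cocycle p) b = 0"
proof (cases "p \<in> T")
  case True
  then show ?thesis using assms dual_cocycle_torsion[of p n]
    by (auto simp: T_def intro!: cochain_eval_boundaries2[where G="UT n"])
next
  case False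
  then have "p \<in> free_index n" using assms by (simp add: I_def T_def)
  then have "0 dvd cochain_eval (dual_cocycle p) b"
    using assms dual_cocycle_free[of p n] by (intro cochain_eval_boundaries2[where G="UT n"]) auto
  then show ?thesis using False by simp
qed

text \<open>Defined so that being a subgroup with all boundaries and relators is immediate from duality;
  the splitting theorem then puts every cycle into it.\<close>

definition detected :: "((nat \<Rightarrow> nat \<Rightarrow> int) list \<Rightarrow>\<^sub>0 int) set" where
  "detected = {c. c - (\<Sum>p\<in>I. frag_cmul (cochain_eval (dual_cocycle p) c) (relator n p)) \<in> boundaries2 (UT n)}"

lemma combination_boundary:
  assumes "\<And>p. p \<in> I \<Longrightarrow> if p \<in> T then even (z p) else z p = 0"
  shows "(\<Sum>p\<in>I. frag_cmul (z p) (relator n p)) \<in> boundaries2 (UT n)"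
proof (rule add_subgroup_sum[OF boundaries2_add_subgroup])
  fix p assume p: "p \<in> I"
  show "frag_cmul (z p) (relator n p) \<in> boundaries2 (UT n)"
  proof (cases "p \<in> T")
    case True
    then obtain m where "z p = m * 2" using assms[OF p] by (auto elim!: evenE)
    then show ?thesis
      using add_subgroup_cmul[OF boundaries2_add_subgroup two_relator[OF True], of m] by simp
  next
    case False
    then show ?thesis using assms[OF p] by (simp add: add_subgroup_0[OF boundaries2_add_subgroup])
  qed
qed

lemma add_subgroup_detected: "add_subgroup detected"
  unfolding add_subgroup_def
proof (intro conjI ballI)
  show "0 \<in> detected" by (simp add: detected_def add_subgroup_0[OF boundaries2_add_subgroup])
next
  fix x y assume "x \<in> detected" "y \<in> detected"
  then have "(x - (\<Sum>p\<in>I. frag_cmul (cochain_eval (dual_cocycle p) x) (relator n p)))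
      - (y - (\<Sum>p\<in>I. frag_cmul (cochain_eval (dual_cocycle p) y) (relator n p))) \<in> boundaries2 (UT n)"
    unfolding detected_def by (auto intro: add_subgroup_diff[OF boundaries2_add_subgroup])
  then show "x - y \<in> detected"
    by (simp add: detected_def cochain_eval_diff frag_cmul_diff_distrib sum_subtractf algebra_simps)
qed

text \<open>On a boundary the coefficients are even at torsion indices and zero elsewhere, so the
  prescribed combination of relators is itself a boundary.\<close>

lemma boundaries2_detected: "boundaries2 (UT n) \<subseteq> detected"
proof
  fix b assume b: "b \<in> boundaries2 (UT n)"
  then have "(\<Sum>p\<in>I. frag_cmul (cochain_eval (dual_cocycle p) b) (relator n p)) \<in> boundaries2 (UT n)"
    using boundary_even by (intro combination_boundary)
  then show "b \<in> detected"
    using add_subgroup_diff[OF boundaries2_add_subgroup b] by (simp add: detected_def)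
qed

lemma cochain_eval_combination:
  assumes "q \<in> I"
  shows "cochain_eval (dual_cocycle q) (\<Sum>p\<in>I. frag_cmul (z p) (relator n p)) = z q"
proof -
  have "cochain_eval (dual_cocycle q) (\<Sum>p\<in>I. frag_cmul (z p) (relator n p)) = (\<Sum>p\<in>I. if q = p then z p else 0)"
    unfolding cochain_eval_sum cochain_eval_cmul
    using assms cochain_eval_relator[of q n] by (intro sum.cong) (auto simp: I_def)
  then show ?thesis using assms finite_index by simp
qed

lemma relator_detected:
  assumes "q \<in> I"
  shows "relator n q \<in> detected"
proof -
  have "(\<Sum>p\<in>I. frag_cmul (cochain_eval (dual_cocycle p) (relator n q)) (relator n p)) =
      (\<Sum>p\<in>I. if p = q then relator n p else 0)"
    using assms cochain_eval_relator[of _ n q] by (intro sum.cong) (auto simp: I_def)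
  also have "\<dots> = relator n q" using assms finite_index by simp
  finally show ?thesis by (simp add: detected_def add_subgroup_0[OF boundaries2_add_subgroup])
qed

lemma cycles2_detected: "cycles2 (UT n) \<subseteq> detected"
proof -
  interpret UT_chain_quotient n detected
    by unfold_locales (auto simp: add_subgroup_detected boundaries2_detected)
  show ?thesis
  proof (rule cycles2_subset, rule swap2_elm_in)
    fix i j assume "Suc (Suc i) \<le> j" "Suc j < n"
    then show "swap2 (e i (Suc i)) (e j (Suc j)) \<in> detected"
      using relator_detected[of "(i, j)"] by (auto simp: I_def free_index_def relator_def Let_def)
  next
    fix i assume "Suc (Suc i) < n"
    then show "swap2 (e i (Suc i)) (e i (Suc (Suc i))) \<in> detected"
      using relator_detected[of "(i, Suc i)"] by (auto simp: I_def free_index_def relator_def Let_def)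
  next
    fix i assume "Suc (Suc i) < n"
    then show "swap2 (e i (Suc (Suc i))) (e (Suc i) (Suc (Suc i))) \<in> detected"
      using relator_detected[of "(Suc i, i)"] by (auto simp: I_def free_index_def relator_def Let_def)
  next
    fix i assume "Suc (Suc (Suc i)) < n"
    then show "swap2 (e i (Suc (Suc i))) (e (Suc i) (Suc (Suc (Suc i)))) \<in> detected"
      using relator_detected[of "(i, i)"] by (auto simp: I_def torsion_index_def relator_def Let_def)
  qed
qed

text \<open>This is injectivity of the final isomorphism: a cycle differs by a boundary from its
  combination of relators, and the stated coefficients make that combination a boundary.\<close>

lemma boundaries2_iff:
  assumes "c \<in> cycles2 (UT n)"
  shows "c \<in> boundaries2 (UT n) \<longleftrightarrow>
    (\<forall>p\<in>I. if p \<in> T then even (cochain_eval (dual_cocycle p) c) else cochain_eval (dual_cocycle p) c = 0)"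
proof
  assume "\<forall>p\<in>I. if p \<in> T then even (cochain_eval (dual_cocycle p) c) else cochain_eval (dual_cocycle p) c = 0"
  then have "(\<Sum>p\<in>I. frag_cmul (cochain_eval (dual_cocycle p) c) (relator n p)) \<in> boundaries2 (UT n)"
    by (intro combination_boundary) auto
  moreover have "c - (\<Sum>p\<in>I. frag_cmul (cochain_eval (dual_cocycle p) c) (relator n p)) \<in> boundaries2 (UT n)"
    using cycles2_detected assms by (auto simp: detected_def)
  ultimately show "c \<in> boundaries2 (UT n)"
    using add_subgroup_add[OF boundaries2_add_subgroup] by fastforce
qed (use boundary_even in blast)

end

text \<open>\<open>Z2_plus_Z\<close> lists its factors of order 2 first, so the numbering has to
  start with the torsion indices.\<close>

lemma torsion_free_enumeration:
  assumes "n \<ge> 3"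
  obtains p where "bij_betw p {..<(n - 3) + (n + 1) * (n - 2) div 2} (torsion_index n \<union> free_index n)"
    "\<And>r. r < (n - 3) + (n + 1) * (n - 2) div 2 \<Longrightarrow> p r \<in> torsion_index n \<longleftrightarrow> r < n - 3"
proof -
  let ?a = "n - 3" and ?b = "(n + 1) * (n - 2) div 2"
  have t: "bij_betw (\<lambda>r. (r, r)) {..<?a} (torsion_index n)"
    by (rule bij_betw_byWitness[where f'=fst]) (auto simp: torsion_index_def)
  have "card {?a..<?a + ?b} = card (free_index n)" using card_free_index[OF assms] by simp
  then obtain f where f: "bij_betw f {?a..<?a + ?b} (free_index n)"
    using finite_same_card_bij[OF finite_atLeastLessThan finite_free_index] by blast
  define p where "p r = (if r < ?a then (r, r) else f r)" for r
  have pt: "bij_betw p {..<?a} (torsion_index n)"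
    using t by (rule bij_betw_cong[THEN iffD1, rotated]) (simp add: p_def)
  have pf: "bij_betw p {?a..<?a + ?b} (free_index n)"
    using f by (rule bij_betw_cong[THEN iffD1, rotated]) (simp add: p_def)
  have "{..<?a + ?b} = {..<?a} \<union> {?a..<?a + ?b}" by auto
  then have "bij_betw p {..<?a + ?b} (torsion_index n \<union> free_index n)"
    using bij_betw_combine[OF pt pf torsion_free_disjoint] by simp
  moreover have "p r \<in> torsion_index n \<longleftrightarrow> r < ?a" if "r < ?a + ?b" for r
  proof (cases "r < ?a")
    case True
    then show ?thesis using bij_betwE[OF pt] by auto
  next
    case False
    then have "p r \<in> free_index n" using that bij_betwE[OF pf] by auto
    then show ?thesis using False torsion_free_disjoint by blast
  qed
  ultimately show thesis by (rule that)
qed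

section \<open>Cycles and the target as groups, and the isomorphism\<close>

lemma chains_simps [simp]:
  "x \<otimes>\<^bsub>chains G k\<^esub> y = x + y" "\<one>\<^bsub>chains G k\<^esub> = 0"
  by (simp_all add: chains_def)

lemma chains_add_subgroup: "add_subgroup (carrier (chains G k))"
  unfolding add_subgroup_def
proof (intro conjI ballI)
  fix a b assume "a \<in> carrier (chains G k)" "b \<in> carrier (chains G k)"
  then show "a - b \<in> carrier (chains G k)" using keys_diff[of a b] unfolding carrier_chains by blast
qed simp

lemma cycles2_add_subgroup: "add_subgroup (cycles2 G)"
  using add_subgroup_diff[OF chains_add_subgroup, of _ G 2] add_subgroup_0[OF chains_add_subgroup, of G 2]
  by (auto simp: cycles2_def add_subgroup_def bd2_diff simp del: carrier_chains)

lemma group_cycles2: "group (chains G 2\<lparr>carrier := cycles2 G\<rparr>)"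
proof (rule groupI)
  fix x assume "x \<in> carrier (chains G 2\<lparr>carrier := cycles2 G\<rparr>)"
  then show "\<exists>y\<in>carrier (chains G 2\<lparr>carrier := cycles2 G\<rparr>).
      y \<otimes>\<^bsub>chains G 2\<lparr>carrier := cycles2 G\<rparr>\<^esub> x = \<one>\<^bsub>chains G 2\<lparr>carrier := cycles2 G\<rparr>\<^esub>"
    by (intro bexI[of _ "- x"]) (auto intro: add_subgroup_uminus[OF cycles2_add_subgroup])
qed (auto intro: add_subgroup_add add_subgroup_0 cycles2_add_subgroup simp: add.assoc)

lemma (in group) boundaries2_subset_cycles2: "boundaries2 G \<subseteq> cycles2 G"
proof (rule boundaries2_subset[OF cycles2_add_subgroup])
  fix x y z assume xyz: "x \<in> carrier G" "y \<in> carrier G" "z \<in> carrier G"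
  let ?b = "frag_of [y, z] - frag_of [x \<otimes> y, z] + frag_of [x, y \<otimes> z] - frag_of [x, y]"
  have "frag_of [u, v] \<in> carrier (chains G 2)" if "u \<in> carrier G" "v \<in> carrier G" for u v
    using that by auto
  then have "?b \<in> carrier (chains G 2)"
    using xyz by (intro add_subgroup_diff add_subgroup_add chains_add_subgroup) auto
  moreover have "bd2 G ?b = 0"
    using xyz bd2_diff[of G "frag_of [y, z] - frag_of [x \<otimes> y, z]" "0 - frag_of [x, y \<otimes> z]"]
      bd2_diff[of G 0 "frag_of [x, y \<otimes> z]"]
    by (simp add: bd2_diff m_assoc)
  ultimately show "?b \<in> cycles2 G" by (simp add: cycles2_def)
qed

lemma carrier_Z2_plus_Z:
  "carrier (Z2_plus_Z a b) = {f \<in> extensional {..<a + b}. \<forall>r<a. 0 \<le> f r \<and> f r < 2}"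
  unfolding Z2_plus_Z_def carrier_product_group PiE_def Pi_def
  by (auto simp: carrier_integer_mod_group split: if_splits)

lemma mult_Z2_plus_Z:
  "f \<otimes>\<^bsub>Z2_plus_Z a b\<^esub> g = (\<lambda>r\<in>{..<a + b}. if r < a then (f r + g r) mod 2 else f r + g r)"
  unfolding Z2_plus_Z_def mult_product_group by (rule restrict_ext) simp

lemma one_Z2_plus_Z: "\<one>\<^bsub>Z2_plus_Z a b\<^esub> = (\<lambda>r\<in>{..<a + b}. 0)"
  unfolding Z2_plus_Z_def one_product_group by (rule restrict_ext) simp

lemma group_Z2_plus_Z: "group (Z2_plus_Z a b)"
  unfolding Z2_plus_Z_def by (rule product_group) simp

lemma H2_UT_iso:
  assumes p: "bij_betw p {..<a + b} (torsion_index n \<union> free_index n)"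
    and pt: "\<And>r. r < a + b \<Longrightarrow> p r \<in> torsion_index n \<longleftrightarrow> r < a"
  shows "H2 (UT n) \<cong> Z2_plus_Z a b"
proof -
  let ?Z = "chains (UT n) 2\<lparr>carrier := cycles2 (UT n)\<rparr>"
  have pI: "p r \<in> torsion_index n \<union> free_index n" if "r < a + b" for r
    using bij_betwE[OF p] that by blast
  define \<psi> where "\<psi> r c = (if r < a then cochain_eval (dual_cocycle (p r)) c mod 2
    else cochain_eval (dual_cocycle (p r)) c)" for r c
  define \<Phi> where "\<Phi> c = (\<lambda>r\<in>{..<a + b}. \<psi> r c)" for c
  have \<psi>_add: "\<psi> r (x + y) = (if r < a then (\<psi> r x + \<psi> r y) mod 2 else \<psi> r x + \<psi> r y)" for r x y
    by (simp add: \<psi>_def cochain_eval_add mod_add_eq)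
  have "\<Phi> \<in> hom ?Z (Z2_plus_Z a b)"
  proof (rule homI)
    fix x show "\<Phi> x \<in> carrier (Z2_plus_Z a b)"
      unfolding carrier_Z2_plus_Z \<Phi>_def by (simp add: \<psi>_def)
  next
    fix x y
    have "x \<otimes>\<^bsub>?Z\<^esub> y = x + y" by simp
    then show "\<Phi> (x \<otimes>\<^bsub>?Z\<^esub> y) = \<Phi> x \<otimes>\<^bsub>Z2_plus_Z a b\<^esub> \<Phi> y"
      unfolding mult_Z2_plus_Z \<Phi>_def by (auto intro!: restrict_ext simp: \<psi>_add)
  qed
  then interpret \<Phi>: group_hom ?Z "Z2_plus_Z a b" \<Phi>
    by (intro group_hom.intro group_cycles2 group_Z2_plus_Z group_hom_axioms.intro)
  have ker: "kernel ?Z (Z2_plus_Z a b) \<Phi> = boundaries2 (UT n)"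
  proof -
    have "\<Phi> c = \<one>\<^bsub>Z2_plus_Z a b\<^esub> \<longleftrightarrow> c \<in> boundaries2 (UT n)" if c: "c \<in> cycles2 (UT n)" for c
    proof -
      have "\<Phi> c = \<one>\<^bsub>Z2_plus_Z a b\<^esub> \<longleftrightarrow> (\<forall>r\<in>{..<a + b}. \<psi> r c = 0)"
        unfolding one_Z2_plus_Z \<Phi>_def restrict_def fun_eq_iff by meson
      also have "\<dots> \<longleftrightarrow> (\<forall>r\<in>{..<a + b}. if p r \<in> torsion_index n
          then even (cochain_eval (dual_cocycle (p r)) c) else cochain_eval (dual_cocycle (p r)) c = 0)"
        by (rule ball_cong) (simp_all add: pt \<psi>_def even_iff_mod_2_eq_zero)
      also have "\<dots> \<longleftrightarrow> (\<forall>q\<in>p ` {..<a + b}. if q \<in> torsion_index n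
          then even (cochain_eval (dual_cocycle q) c) else cochain_eval (dual_cocycle q) c = 0)"
        by (simp only: ball_simps)
      also have "\<dots> \<longleftrightarrow> c \<in> boundaries2 (UT n)"
        unfolding bij_betw_imp_surj_on[OF p] by (rule boundaries2_iff[OF c, symmetric])
      finally show ?thesis .
    qed
    moreover have "boundaries2 (UT n) \<subseteq> cycles2 (UT n)"
      by (rule group.boundaries2_subset_cycles2[OF UT_group])
    ultimately show ?thesis unfolding kernel_def by fastforce
  qed
  have "\<Phi> ` carrier ?Z = carrier (Z2_plus_Z a b)"
  proof
    show "\<Phi> ` carrier ?Z \<subseteq> carrier (Z2_plus_Z a b)" using \<Phi>.hom_closed by blast
    show "carrier (Z2_plus_Z a b) \<subseteq> \<Phi> ` carrier ?Z"
    proof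
      fix f assume "f \<in> carrier (Z2_plus_Z a b)"
      then have f: "f \<in> extensional {..<a + b}" "\<And>r. r < a \<Longrightarrow> 0 \<le> f r \<and> f r < 2"
        unfolding carrier_Z2_plus_Z by auto
      \<comment> \<open>Surjectivity by duality: the relators weighted with the coordinates of
        \<open>f\<close> have exactly these coordinates, and reduction modulo 2 does not alter
        values in \<open>{0, 1}\<close>.\<close>
      define z where "z q = f (inv_into {..<a + b} p q)" for q
      define c where "c = (\<Sum>q\<in>torsion_index n \<union> free_index n. frag_cmul (z q) (relator n q))"
      have "\<psi> r c = f r" if r: "r < a + b" for r
      proof -
        have "z (p r) = f r" using r bij_betw_inv_into_left[OF p] by (simp add: z_def)
        then have "cochain_eval (dual_cocycle (p r)) c = f r"
          unfolding c_def cochain_eval_combination[OF pI[OF r]] .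
        then show ?thesis using f(2)[of r] by (simp add: \<psi>_def)
      qed
      then have "\<Phi> c = f"
        unfolding \<Phi>_def using f(1) by (intro extensionalityI[of _ "{..<a + b}"]) simp_all
      moreover have "c \<in> carrier ?Z"
        unfolding c_def
        by (simp, intro add_subgroup_sum add_subgroup_cmul cycles2_add_subgroup relator_cycle)
      ultimately show "f \<in> \<Phi> ` carrier ?Z" by blast
    qed
  qed
  from \<Phi>.FactGroup_iso[OF this] show ?thesis
    unfolding H2_def ker .
qed

theorem mainTheorem6:
  fixes n :: nat
  assumes "n \<ge> 3"
  shows "H2 (UT n) \<cong> Z2_plus_Z (n - 3) ((n + 1) * (n - 2) div 2)"
  using torsion_free_enumeration[OF assms] H2_UT_iso by metis

end
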